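(* Let $r^1,\ldots,r^k\in\mathbb{Z}^n$ be linearly independent, let $R=(r^1,\ldots,r^k)\in\mathbb{Z}^{n\times k}$, and let $L=\operatorname{lin}R$. If the set of cosets $$\{(r^1)^*+(L\cap\mathbb{Z}^n)^*,\ldots,(r^k)^*+(L\cap\mathbb{Z}^n)^*\}\subseteq (R\mathbb{Z}^k)^*/(L\cap\mathbb{Z}^n)^*$$ contains at most three non-trivial pairwise different elements, then $\operatorname{pos}R$ has the integral Carathéodory property, that is, $\operatorname{ICR}(\operatorname{pos}R)=k$.
   Context: For a matrix $R$, $\operatorname{lin}R$ is the linear span of its columns and $\operatorname{pos}R$ is the set of all non-negative real linear combinations of its columns. The dual basis $(r^1)^*,\ldots,(r^k)^*\in L$ of $r^1,\ldots,r^k$ is defined by $(r^i)^T(r^j)^*=1$ if $i=j$ and $0$ otherwise. For a lattice (discrete subgroup) $\Lambda\subseteq\mathbb{R}^n$, the dual lattice is $\Lambda^*:=\{x\in\operatorname{lin}\Lambda : y^Tx\in\mathbb{Z}\text{ for all }y\in\Lambda\}$, where $\operatorname{lin}\Lambda$ is the linear span of $\Lambda$. $\mathbb{N}$ denotes the non-negative integers. For a pointed rational cone $C\subseteq\mathbb{R}^n$, the Hilbert basis $\mathcal{H}(C)$ is the unique minimal set of vectors in $C\cap\mathbb{Z}^n$ such that every element of $C\cap\mathbb{Z}^n$ is a non-negative integral combination of elements of the set (it is finite). The integer Carathéodory rank of $C$ is $$\operatorname{ICR}(C):=\max_{z\in C\cap\mathbb{Z}^n}\min\Big\{m : z=\sum_{i=1}^m\lambda_i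 h^i\text{ with }\lambda_i\in\mathbb{N},\ h^i\in\mathcal{H}(C)\text{ for all }i\in\{1,\ldots,m\}\Big\}.$$ A cone has the integral Carathéodory property if its integer Carathéodory rank equals its dimension. *)

theory Defs
  imports "HOL-Analysis.Analysis" "HOL-Library.Set_Algebras"
begin

text \<open>
  A matrix with columns \<open>r 1, \<dots>, r k\<close> is represented by the family \<open>r\<close>, of which only the
  values on \<open>{1..k}\<close> matter; the span of its columns is \<open>span (r ` {1..k})\<close>.
\<close>

definition integer_points :: "(real ^ 'n) set" where
  "integer_points = {x. \<forall>i. x $ i \<in> \<int>}"

definition lin_indep_family :: "nat \<Rightarrow> (nat \<Rightarrow> real ^ 'n) \<Rightarrow> bool" where
  "lin_indep_family k r \<longleftrightarrow> inj_on r {1..k} \<and> independent (r ` {1..k})"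

definition pos_hull :: "nat \<Rightarrow> (nat \<Rightarrow> real ^ 'n) \<Rightarrow> (real ^ 'n) set" where
  "pos_hull k r = {\<Sum>i=1..k. c i *\<^sub>R r i | c. \<forall>i\<in>{1..k}. (0::real) \<le> c i}"

definition int_hull :: "nat \<Rightarrow> (nat \<Rightarrow> real ^ 'n) \<Rightarrow> (real ^ 'n) set" where
  "int_hull k r = {\<Sum>i=1..k. of_int (c i) *\<^sub>R r i | c :: nat \<Rightarrow> int. True}"

definition dual_lattice :: "(real ^ 'n) set \<Rightarrow> (real ^ 'n) set" where
  "dual_lattice \<Lambda> = {x \<in> span \<Lambda>. \<forall>y\<in>\<Lambda>. y \<bullet> x \<in> \<int>}"

text \<open>The description below is that of a unique vector if the family is linearly independent; see
  \<open>dual_basis_unique\<close>.\<close>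

definition dual_basis :: "nat \<Rightarrow> (nat \<Rightarrow> real ^ 'n) \<Rightarrow> nat \<Rightarrow> real ^ 'n" where
  "dual_basis k r j =
     (THE x. x \<in> span (r ` {1..k}) \<and> (\<forall>i\<in>{1..k}. r i \<bullet> x = (if i = j then 1 else 0)))"

definition nat_combinations :: "(real ^ 'n) set \<Rightarrow> (real ^ 'n) set" where
  "nat_combinations H =
     {\<Sum>h\<in>F. of_nat (c h) *\<^sub>R h | F (c :: real ^ 'n \<Rightarrow> nat). finite F \<and> F \<subseteq> H}"

definition hilbert_generating :: "(real ^ 'n) set \<Rightarrow> (real ^ 'n) set \<Rightarrow> bool" where
  "hilbert_generating C H \<longleftrightarrow>
     H \<subseteq> C \<inter> integer_points \<and> C \<inter> integer_points \<subseteq> nat_combinations H"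

text \<open>Minimality is with respect to inclusion; the minimal set is unique for pointed rational
  cones, the only ones for which this definition is meant. The Hilbert basis of \<open>{0}\<close> is empty.\<close>

definition hilbert_basis :: "(real ^ 'n) set \<Rightarrow> (real ^ 'n) set" where
  "hilbert_basis C =
     (THE H. hilbert_generating C H \<and> (\<forall>H'\<subseteq>H. hilbert_generating C H' \<longrightarrow> H' = H))"

definition hilbert_length :: "(real ^ 'n) set \<Rightarrow> real ^ 'n \<Rightarrow> nat" where
  "hilbert_length C z =
     (LEAST m. \<exists>(l :: nat \<Rightarrow> nat) h.
        (\<forall>i\<in>{1..m}. h i \<in> hilbert_basis C) \<and> z = (\<Sum>i=1..m. of_nat (l i) *\<^sub>R h i))"

text \<open>The lengths are bounded by the cardinality of the (finite) Hilbert basis of a pointed rational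
  cone, so \<open>Max\<close> is applied to a finite nonempty set of natural numbers.\<close>

definition ICR :: "(real ^ 'n) set \<Rightarrow> nat" where
  "ICR C = Max (hilbert_length C ` (C \<inter> integer_points))"

definition integral_caratheodory :: "(real ^ 'n) set \<Rightarrow> bool" where
  "integral_caratheodory C \<longleftrightarrow> ICR C = dim C"

lemma dual_basis_unique:
  fixes r :: "nat \<Rightarrow> real ^ 'n"
  assumes "lin_indep_family k r" and j: "j \<in> {1..k}"
  shows "\<exists>!x. x \<in> span (r ` {1..k}) \<and> (\<forall>i\<in>{1..k}. r i \<bullet> x = (if i = j then 1 else 0))"
proof -
  let ?S = "r ` {1..k}"
  have inj: "inj_on r {1..k}" and ind: "independent ?S"
    using assms by (auto simp: lin_indep_family_def)
  obtain f :: "real ^ 'n \<Rightarrow> real" where f: "linear f"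
    and fS: "\<forall>x\<in>?S. f x = (if x = r j then 1 else 0)"
    using linear_independent_extend[OF ind, of "\<lambda>x. if x = r j then 1 else 0"] by blast
  define w where "w = adjoint f 1"
  have fw: "f x = x \<bullet> w" for x
    using adjoint_works[OF f, of x 1] by (simp add: w_def)
  obtain y z where y: "y \<in> span ?S" and z: "\<And>v. v \<in> span ?S \<Longrightarrow> orthogonal z v" and w: "w = y + z"
    using orthogonal_subspace_decomp_exists[of ?S w] by metis
  have ry: "r i \<bullet> y = (if i = j then 1 else 0)" if i: "i \<in> {1..k}" for i
  proof -
    have "r i \<bullet> z = 0"
      using z[of "r i"] i by (auto simp: orthogonal_def inner_commute span_base)
    then have "r i \<bullet> y = f (r i)"
      by (simp add: fw w inner_add_right)
    moreover have "r i = r j \<longleftrightarrow> i = j"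
      using inj i j by (auto dest: inj_onD)
    ultimately show ?thesis
      using fS i by auto
  qed
  show ?thesis
  proof (intro ex1I[of _ y] conjI ballI)
    fix x assume x: "x \<in> span ?S \<and> (\<forall>i\<in>{1..k}. r i \<bullet> x = (if i = j then 1 else 0))"
    have "orthogonal (x - y) v" if "v \<in> ?S" for v
      using that x ry by (auto simp: orthogonal_def inner_diff_left inner_commute[of _ "r _"])
    moreover have "x - y \<in> span ?S"
      using x y by (simp add: span_diff)
    ultimately have "orthogonal (x - y) (x - y)"
      using orthogonal_to_span by blast
    then show "x = y"
      by (simp add: orthogonal_def)
  qed (use y ry in auto)
qed

text \<open>The cosets of the dual basis vectors are elements of the quotient of the dual of the lattice
  generated by the family.\<close>

lemma dual_basis_in_dual_lattice:
  fixes r :: "nat \<Rightarrow> real ^ 'n"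
  assumes "lin_indep_family k r" and "j \<in> {1..k}"
  shows "dual_basis k r j \<in> dual_lattice (int_hull k r)"
proof -
  let ?d = "dual_basis k r j"
  have d: "?d \<in> span (r ` {1..k})" and rd: "\<forall>i\<in>{1..k}. r i \<bullet> ?d = (if i = j then 1 else 0)"
    using theI'[OF dual_basis_unique[OF assms]] unfolding dual_basis_def by auto
  have "r i \<in> int_hull k r" if "i \<in> {1..k}" for i
  proof -
    have "r i = (\<Sum>l=1..k. of_int (if l = i then 1 else 0) *\<^sub>R r l)"
      using that by (simp add: if_distrib[of "\<lambda>x. of_int x *\<^sub>R _"] sum.delta cong: if_cong)
    then show ?thesis
      unfolding int_hull_def by (intro CollectI exI[of _ "\<lambda>l. if l = i then 1 else 0"]) simp
  qed
  then have "span (r ` {1..k}) \<subseteq> span (int_hull k r)"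
    by (intro span_mono) auto
  moreover have "y \<bullet> ?d \<in> \<int>" if "y \<in> int_hull k r" for y
    using that rd by (auto simp: int_hull_def inner_sum_left intro!: Ints_sum)
  ultimately show ?thesis
    using d by (auto simp: dual_lattice_def)
qed

end

theory Submission
  imports Defs
begin

text \<open>
  Write \<open>L\<close> for the span of the columns, \<open>\<Lambda>\<close> for the lattice of integer points of \<open>L\<close>, and call
  the inner products of a point with the dual basis its coordinates. Two equal cosets mean that the
  corresponding coordinates of any point of \<open>\<Lambda>\<close> differ by an integer, and a trivial coset means
  that the coordinate is an integer on \<open>\<Lambda>\<close>. Hence a lattice point of the cone is the sum of a
  natural combination of the \<open>r i\<close>, in which at least one index of each nontrivial class does not
  occur, and a point of the \<^emph>\<open>diagonal\<close> sublattice: the lattice points whose coordinates vanish on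
  the trivial class and are constant on each of the other classes. The diagonal sublattice has rank
  at most the number of nontrivial classes, which is at most three. If the diagonal point is a natural
  combination of so few generators, then together with the \<open>r i\<close> this uses at most \<open>k\<close> elements of
  the Hilbert basis (\<open>coset_classes.short_rep_k\<close>); the generators are the irreducible points on the
  diagonal and the sums of the \<open>r i\<close> over a class with at least two elements. That \<open>k\<close> elements
  are sometimes necessary follows by placing a point of a moment curve outside the finitely many
  proper subspaces spanned by fewer than \<open>k\<close> elements (\<open>simplicial_cone.long_point_exists\<close>).

  What remains is the integral Caratheodory property for cones of dimension at most three, a theorem
  of Sebo (\<open>cone_generators.integral_caratheodory_dim3\<close>). Among the representations of the given
  point \<open>x\<close> as a nonnegative real combination of the generators, choose one with linearly
  independent support that maximises the sum of the coefficients and, among those, minimises the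
  sum of the coefficients weighted by the squared norms. Geometrically the support lies on a compact
  face of the convex hull of the nonzero lattice points of the cone and spans there a simplex of a
  Delaunay triangulation. Comparing \<open>x\<close> with perturbed representations shows that the half-open parallelepiped
  over the support has no nonzero lattice point unless the support has three elements, and that in
  this case all such points are generators with coefficient sum strictly between one and two.

  White's terminal lemma (\<open>empty_simplex_pair_integral\<close>) now states that for some two of the
  three coefficients the sum is an integer on the lattice. It is reduced to the statement that the jumps
  of three floor sequences of slope at least \<open>2 / q\<close> cannot partition \<open>{2..<q}\<close> (\<open>three_floor_sums\<close>). In the
  resulting configuration the cone is subdivided at the lattice point of the parallelepiped whose
  third coefficient is least; one of the pieces is unimodular and the other two are smaller configurations of the same
  kind (\<open>additive_group_in.slab_nat_comb3\<close>).
\<close>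

section \<open>White's terminal lemma\<close>

text \<open>
  The hypothesis says that each of the steps \<open>2, \<dots>, q - 1\<close> is a jump of exactly one of the three
  sequences \<open>\<lfloor>j * y\<rfloor>\<close>. If the first jump of the \<open>y2\<close>-sequence is at \<open>m + 1\<close>, then all earlier steps are jumps of the \<open>y1\<close>-sequence,
  so that in any \<open>m\<close> consecutive steps it misses at most one jump. The first jump of the \<open>y3\<close>-sequence
  is such a miss; hence the \<open>y2\<close>-sequence does not jump within distance \<open>m - 1\<close> of it on either side,
  although it jumps at least once in any \<open>m + 1 \<le> 2 * m - 1\<close> consecutive steps. Since \<open>y3 \<ge> 2 / q\<close>,
  all these steps are below \<open>q\<close>.
\<close>

lemma three_floor_sums:
  fixes q :: nat and y1 y2 y3 :: real
  assumes "y1 < 1" "y2 \<le> y1" "y3 \<le> y2" "2 / q \<le> y3" "0 < q"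
    and sum: "\<And>j::nat. 1 \<le> j \<Longrightarrow> j < q \<Longrightarrow> \<lfloor>j * y1\<rfloor> + \<lfloor>j * y2\<rfloor> + \<lfloor>j * y3\<rfloor> = int j - 1"
  shows False
proof -
  have pos: "0 < y3" "0 < y2" "0 < y1"
    using assms by (smt (verit) divide_pos_pos of_nat_0_less_iff)+
  have "2 / q < 1" using assms by linarith
  then have q2: "2 < q" using \<open>0 < q\<close> by (simp add: field_simps)
  have y2: "2 * y2 < 1"
  proof (rule ccontr)
    assume "\<not> 2 * y2 < 1"
    then have "1 \<le> \<lfloor>2 * y2\<rfloor>" "1 \<le> \<lfloor>2 * y1\<rfloor>" "0 \<le> \<lfloor>2 * y3\<rfloor>"
      using assms pos by (auto simp: le_floor_iff)
    moreover have "\<lfloor>2 * y1\<rfloor> + \<lfloor>2 * y2\<rfloor> + \<lfloor>2 * y3\<rfloor> = 1" using sum[of 2] q2 by simp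
    ultimately show False by linarith
  qed
  have first_jump: "\<exists>m::nat. m * y < 1 \<and> 1 \<le> (real m + 1) * y" if "0 < y" for y :: real
  proof -
    define m where "m = nat (\<lceil>1 / y\<rceil> - 1)"
    have "1 \<le> \<lceil>1 / y\<rceil>" using that by (simp add: less_ceiling_iff one_le_ceiling)
    then have "real m = of_int \<lceil>1 / y\<rceil> - 1" by (simp add: m_def)
    then have "real m < 1 / y" "1 / y \<le> real m + 1" by linarith+
    then show ?thesis using that by (auto simp: field_simps intro!: exI[of _ m])
  qed
  obtain m :: nat where m: "m * y2 < 1" "1 \<le> (real m + 1) * y2" using first_jump[OF pos(2)] by metis
  obtain M :: nat where M: "M * y3 < 1" "1 \<le> (real M + 1) * y3" using first_jump[OF pos(1)] by metis
  have m2: "2 \<le> m"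
  proof (rule ccontr)
    assume "\<not> 2 \<le> m"
    then have "(real m + 1) * y2 \<le> 2 * y2" using pos by (intro mult_right_mono) auto
    then show False using m y2 by simp
  qed
  have mM: "m \<le> M"
  proof (rule ccontr)
    assume "\<not> m \<le> M"
    then have "(real M + 1) * y3 \<le> m * y2" using assms pos by (intro mult_mono) auto
    then show False using M m by simp
  qed
  have half: "real j < q / 2" if "j * y < 1" "2 / q \<le> y" for j :: nat and y :: real
  proof -
    have "j * (2 / q) \<le> j * y" using that by (intro mult_left_mono) auto
    then have "j * (2 / q) < 1" using that by linarith
    then show ?thesis using \<open>0 < q\<close> by (simp add: field_simps)
  qed
  have "real m < q / 2" "real M < q / 2" using half m M assms by (metis order_trans)+
  then have "real (M + m) < q" by simp
  then have lt: "M + m < q" by linarith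
  define F where "F = (\<lambda>(y::real) (j::nat). \<lfloor>j * y\<rfloor>)"
  have F_sum: "F y1 j + F y2 j + F y3 j = int j - 1" if "1 \<le> j" "j < q" for j
    using sum[OF that] by (simp add: F_def)
  have F_mono: "F y i \<le> F y j" if "0 < y" "i \<le> j" for y i j
    unfolding F_def using that by (intro floor_mono mult_right_mono) auto
  have F0: "F y3 j = 0" if "j \<le> M" for j
  proof -
    have "j * y3 \<le> M * y3" using that pos by (intro mult_right_mono) auto
    then have "j * y3 < 1" using M by linarith
    then show ?thesis using pos by (simp add: F_def floor_eq_iff)
  qed
  have F_add: "F y i + t \<le> F y (i + j)" if "of_int t \<le> j * y" for y t i j
  proof -
    have "real i * y + of_int t \<le> real (i + j) * y" using that by (simp add: algebra_simps)
    then have "\<lfloor>real i * y + of_int t\<rfloor> \<le> \<lfloor>real (i + j) * y\<rfloor>" by (rule floor_mono)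
    then show ?thesis by (simp add: F_def)
  qed
  have F3: "1 \<le> F y3 (M + 1)" using M by (simp add: F_def le_floor_iff add.commute)
  have "F y2 m = 0" using m pos by (simp add: F_def floor_eq_iff)
  then have "F y1 m = int m - 1" using F_sum[of m] F0[OF mM] m2 lt by simp
  then have my1: "of_int (int m - 1) \<le> m * y1" unfolding F_def by linarith
  define A where "A = M - m + 1"
  have A: "A + m = M + 1" "1 \<le> A" "A \<le> M" using mM m2 by (auto simp: A_def)
  have "F y2 (M + 1) \<le> F y2 A"
    using F_sum[of A] F_sum[of "M + 1"] F_add[OF my1, of A] F3 F0[of A] A lt m2 by simp
  moreover have "F y2 (M + m) \<le> F y2 M"
    using F_sum[of M] F_sum[of "M + m"] F_add[OF my1, of M] F3 F0[of M] F_mono[of y3 "M + 1" "M + m"]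
      pos A lt m2 by simp
  moreover have "F y2 M \<le> F y2 (M + 1)" using F_mono pos by simp
  moreover have "F y2 A + 1 \<le> F y2 (A + (m + 1))" using F_add[of 1 "m + 1" y2 A] m by (simp add: add.commute)
  moreover have "F y2 (A + (m + 1)) \<le> F y2 (M + m)" using A m2 pos by (intro F_mono) auto
  ultimately show False by simp
qed

text \<open>
  The \<open>y\<close> are multiples of \<open>1 / q\<close>; if none of them is \<open>1 / q\<close> itself, sorting them leads to the
  impossible configuration above.
\<close>

lemma three_floor_sums_unit:
  fixes q :: nat and y1 y2 y3 :: real
  assumes "0 < q" "y1 < 1" "y2 < 1" "y3 < 1" "0 < y1" "0 < y2" "0 < y3"
    and "q * y1 \<in> \<int>" "q * y2 \<in> \<int>" "q * y3 \<in> \<int>"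
    and sum: "\<And>j::nat. 1 \<le> j \<Longrightarrow> j < q \<Longrightarrow> \<lfloor>j * y1\<rfloor> + \<lfloor>j * y2\<rfloor> + \<lfloor>j * y3\<rfloor> = int j - 1"
  shows "y1 = 1 / q \<or> y2 = 1 / q \<or> y3 = 1 / q"
proof (rule ccontr)
  assume no: "\<not> ?thesis"
  have ge2: "2 / q \<le> y" if "q * y \<in> \<int>" "0 < y" "y \<noteq> 1 / q" for y :: real
  proof -
    from that(1) obtain c where c: "q * y = of_int c" by (rule Ints_cases)
    have "y = 1 / q" if "c = 1" using c that \<open>0 < q\<close> by (simp add: eq_divide_eq mult.commute)
    then have "c \<noteq> 1" using \<open>y \<noteq> 1 / q\<close> by blast
    moreover have "0 < (of_int c :: real)" using that \<open>0 < q\<close> unfolding c[symmetric] by simp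
    ultimately have "2 \<le> c" by simp
    then have "2 \<le> q * y" unfolding c by simp
    then show ?thesis using \<open>0 < q\<close> by (simp add: field_simps)
  qed
  have ge: "2 / q \<le> y1" "2 / q \<le> y2" "2 / q \<le> y3" using ge2 assms no by auto
  have sum': "\<lfloor>j * y1\<rfloor> + (\<lfloor>j * y2\<rfloor> + \<lfloor>j * y3\<rfloor>) = int j - 1" if "1 \<le> j" "j < q" for j :: nat
    using sum[OF that] by simp
  consider "y2 \<le> y1" "y3 \<le> y2" | "y3 \<le> y1" "y2 \<le> y3" | "y1 \<le> y2" "y3 \<le> y1"
    | "y3 \<le> y2" "y1 \<le> y3" | "y1 \<le> y3" "y2 \<le> y1" | "y2 \<le> y3" "y1 \<le> y2" by linarith
  then show False
  proof cases
    case 1 show ?thesis by (rule three_floor_sums[of y1 y2 y3 q]) (use 1 assms ge sum' in \<open>simp_all add: ac_simps\<close>)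
  next
    case 2 show ?thesis by (rule three_floor_sums[of y1 y3 y2 q]) (use 2 assms ge sum' in \<open>simp_all add: ac_simps\<close>)
  next
    case 3 show ?thesis by (rule three_floor_sums[of y2 y1 y3 q]) (use 3 assms ge sum' in \<open>simp_all add: ac_simps\<close>)
  next
    case 4 show ?thesis by (rule three_floor_sums[of y2 y3 y1 q]) (use 4 assms ge sum' in \<open>simp_all add: ac_simps\<close>)
  next
    case 5 show ?thesis by (rule three_floor_sums[of y3 y1 y2 q]) (use 5 assms ge sum' in \<open>simp_all add: ac_simps\<close>)
  next
    case 6 show ?thesis by (rule three_floor_sums[of y3 y2 y1 q]) (use 6 assms ge sum' in \<open>simp_all add: ac_simps\<close>)
  qed
qed

definition unit_cube :: "(real \<times> real \<times> real) set" where
  "unit_cube = {0..<1} \<times> {0..<1} \<times> {0..<1}"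

lemma frac_in_unit_cube: "(frac a, frac b, frac c) \<in> unit_cube"
  by (simp add: unit_cube_def frac_lt_1)

text \<open>
  Here \<open>K\<close> is a lattice in the coordinates given by the three edges at a vertex of an empty lattice
  tetrahedron. No nonzero class of \<open>K\<close> modulo the integer vectors has an integral coordinate, so \<open>K\<close>
  is generated modulo integer vectors by the nonzero point \<open>g\<close> of the cube with least first
  coordinate, which is \<open>1 / q\<close> for a natural number \<open>q\<close>. With the fourth coordinate
  \<open>2 - (g1 + g2 + g3)\<close> the fractional parts of each nonzero class sum up to two; for the multiples of
  \<open>-g\<close> this yields the three floor sequences, and a slope \<open>1 / q = g1\<close> among them means that \<open>g1 + g2\<close>,
  \<open>g1 + g3\<close> or \<open>g2 + g3\<close> is one.
\<close>

theorem empty_simplex_pair_integral: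
  fixes K :: "(real \<times> real \<times> real) set"
  assumes diff: "\<And>g h. g \<in> K \<Longrightarrow> h \<in> K \<Longrightarrow> g - h \<in> K"
    and ints: "\<And>a b c. a \<in> \<int> \<Longrightarrow> b \<in> \<int> \<Longrightarrow> c \<in> \<int> \<Longrightarrow> (a, b, c) \<in> K"
    and fin: "finite (K \<inter> unit_cube)"
    and empty: "\<And>a b c. (a, b, c) \<in> K \<inter> unit_cube - {0} \<Longrightarrow>
      0 < a \<and> 0 < b \<and> 0 < c \<and> 1 < a + b + c \<and> a + b + c < 2"
  shows "(\<forall>(a, b, c)\<in>K. a + b \<in> \<int>) \<or> (\<forall>(a, b, c)\<in>K. a + c \<in> \<int>) \<or> (\<forall>(a, b, c)\<in>K. b + c \<in> \<int>)"
proof -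
  have fracK: "(frac a, frac b, frac c) \<in> K \<inter> unit_cube" if "(a, b, c) \<in> K" for a b c
    using diff[OF that ints[of "of_int \<lfloor>a\<rfloor>" "of_int \<lfloor>b\<rfloor>" "of_int \<lfloor>c\<rfloor>"]] frac_in_unit_cube
    by (simp add: frac_def)
  have frac_sum: "1 < frac a + frac b + frac c \<and> frac a + frac b + frac c < 2"
    if "(a, b, c) \<in> K" "a \<notin> \<int>" for a b c
    using empty[of "frac a" "frac b" "frac c"] fracK that by (simp add: zero_prod_def)
  have all_int: "b \<in> \<int> \<and> c \<in> \<int>" if "(a, b, c) \<in> K" "a \<in> \<int>" for a b c
    using empty[of "frac a" "frac b" "frac c"] fracK[OF that(1)] that(2)
    by (auto simp: zero_prod_def)
  show ?thesis
  proof (cases "K \<inter> unit_cube - {0} = {}")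
    case True
    have "a \<in> \<int> \<and> b \<in> \<int> \<and> c \<in> \<int>" if "(a, b, c) \<in> K" for a b c
      using fracK[OF that] True by (auto simp: zero_prod_def)
    then show ?thesis by (auto intro!: Ints_add)
  next
    case False
    define g where "g = arg_min_on fst (K \<inter> unit_cube - {0})"
    have g: "g \<in> K \<inter> unit_cube - {0}"
      and gmin: "\<And>h. h \<in> K \<inter> unit_cube - {0} \<Longrightarrow> fst g \<le> fst h"
      using fin False by (auto simp only: g_def finite_Diff intro!: arg_min_if_finite(1) arg_min_least)
    obtain g1 g2 g3 where g_eq: "g = (g1, g2, g3)" by (cases g)
    have g1: "0 < g1" "g1 < 1" and g2: "0 < g2" "g2 < 1" and g3: "0 < g3" "g3 < 1"
      and gs: "1 < g1 + g2 + g3" "g1 + g2 + g3 < 2"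
      using empty[of g1 g2 g3] g by (auto simp: g_eq unit_cube_def)
    have nat_mult: "(j * g1, j * g2, j * g3) \<in> K" for j :: nat
    proof (induction j)
      case 0 show ?case using ints[of 0 0 0] by simp
    next
      case (Suc j)
      have "(- g1, - g2, - g3) \<in> K" using diff[OF ints[of 0 0 0]] g by (force simp: g_eq)
      from diff[OF Suc this] show ?case by (simp add: algebra_simps)
    qed
    have neg_mult: "(- (j * g1), - (j * g2), - (j * g3)) \<in> K" for j :: nat
      using diff[OF ints[of 0 0 0] nat_mult[of j]] by simp
    have int_mult: "(of_int j * g1, of_int j * g2, of_int j * g3) \<in> K" for j :: int
      using nat_mult[of "nat j"] neg_mult[of "nat (- j)"] by (cases "0 \<le> j") auto
    have gen: "a - \<lfloor>a / g1\<rfloor> * g1 \<in> \<int> \<and> b - \<lfloor>a / g1\<rfloor> * g2 \<in> \<int> \<and> c - \<lfloor>a / g1\<rfloor> * g3 \<in> \<int>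
        \<and> 0 \<le> a - \<lfloor>a / g1\<rfloor> * g1 \<and> a - \<lfloor>a / g1\<rfloor> * g1 < g1"
      if abc: "(a, b, c) \<in> K" for a b c
    proof -
      define j where "j = \<lfloor>a / g1\<rfloor>"
      have K: "(a - j * g1, b - j * g2, c - j * g3) \<in> K" using diff[OF abc int_mult[of j]] by simp
      have "a - j * g1 = frac (a / g1) * g1" using g1 by (simp add: frac_def j_def field_simps)
      then have 1: "0 \<le> a - j * g1" "a - j * g1 < g1" using g1 frac_lt_1[of "a / g1"] by auto
      then have "frac (a - j * g1) = a - j * g1" using g1 by (intro frac_eq[THEN iffD2]) auto
      then have "a - j * g1 \<in> \<int>"
        using gmin[of "(frac (a - j * g1), frac (b - j * g2), frac (c - j * g3))"] fracK[OF K] 1(2)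
        by (force simp: g_eq zero_prod_def simp flip: frac_eq_0_iff)
      then show ?thesis using all_int[OF K] 1 by (simp add: j_def)
    qed
    define q where "q = nat \<lfloor>1 / g1\<rfloor>"
    have "0 \<le> \<lfloor>1 / g1\<rfloor>" using g1 by simp
    then have q: "real q = \<lfloor>1 / g1\<rfloor>" by (simp add: q_def)
    have qg: "1 - q * g1 \<in> \<int>" "q * g2 \<in> \<int>" "q * g3 \<in> \<int>" "0 \<le> 1 - q * g1" "1 - q * g1 < 1"
      using gen[OF ints[of 1 0 0]] g1 by (auto simp: q)
    then have "1 - q * g1 = 0" by (auto elim!: Ints_cases)
    then have q1: "q * g1 = 1" by simp
    then have "0 < q" by (cases q) auto
    have "1 - g2 = 1 / q \<or> 1 - g3 = 1 / q \<or> g1 + g2 + g3 - 1 = 1 / q"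
    proof (rule three_floor_sums_unit)
      show "q * (1 - g2) \<in> \<int>" "q * (1 - g3) \<in> \<int>"
        using qg by (simp_all add: right_diff_distrib)
      have "q * (g1 + g2 + g3 - 1) = 1 + q * g2 + q * g3 - q" by (simp add: algebra_simps flip: q1)
      then show "q * (g1 + g2 + g3 - 1) \<in> \<int>" using qg by simp
      fix j :: nat assume j: "1 \<le> j" "j < q"
      have "j * g1 < q * g1" using j g1 by simp
      then have jg: "0 < j * g1" "j * g1 < 1" using g1 q1 j by auto
      then have "\<lfloor>- (j * g1)\<rfloor> = -1" by (simp add: floor_eq_iff)
      then have fr: "frac (- (j * g1)) = 1 - j * g1" by (simp add: frac_def)
      then have "- (j * g1) \<notin> \<int>" using jg by (metis diff_gt_0_iff_gt frac_eq_0_iff less_irrefl)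
      from frac_sum[OF neg_mult this]
      have s: "1 < 1 - j * g1 + frac (- (j * g2)) + frac (- (j * g3))"
        "1 - j * g1 + frac (- (j * g2)) + frac (- (j * g3)) < 2" by (auto simp: fr)
      define P Q where "P = \<lfloor>- (j * g2)\<rfloor>" and "Q = \<lfloor>- (j * g3)\<rfloor>"
      have "j * (1 - g2) = - (j * g2) + of_int (int j)" "j * (1 - g3) = - (j * g3) + of_int (int j)"
        by (simp_all add: algebra_simps)
      then have "\<lfloor>j * (1 - g2)\<rfloor> = P + int j" "\<lfloor>j * (1 - g3)\<rfloor> = Q + int j"
        unfolding P_def Q_def by (metis floor_add_int)+
      moreover have "\<lfloor>j * (g1 + g2 + g3 - 1)\<rfloor> = - 1 - P - Q - int j"
        using s unfolding frac_def P_def[symmetric] Q_def[symmetric]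
        by (intro floor_unique) (simp_all add: algebra_simps)
      ultimately show "\<lfloor>j * (1 - g2)\<rfloor> + \<lfloor>j * (1 - g3)\<rfloor> + \<lfloor>j * (g1 + g2 + g3 - 1)\<rfloor> = int j - 1"
        by simp
    qed (use \<open>0 < q\<close> g1 g2 g3 gs in auto)
    moreover have "1 / q = g1" using q1 \<open>0 < q\<close> by (simp add: field_simps)
    ultimately consider "g1 + g2 = 1" | "g1 + g3 = 1" | "g2 + g3 = 1" by argo
    then show ?thesis
    proof cases
      case 1
      have "a + b \<in> \<int>" if "(a, b, c) \<in> K" for a b c
      proof -
        have "a + b = (a - \<lfloor>a / g1\<rfloor> * g1) + (b - \<lfloor>a / g1\<rfloor> * g2) + \<lfloor>a / g1\<rfloor> * (g1 + g2)"
          by (simp add: algebra_simps)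
        then show ?thesis using gen[OF that] 1 by (metis Ints_add Ints_of_int mult.right_neutral)
      qed
      then show ?thesis by auto
    next
      case 2
      have "a + c \<in> \<int>" if "(a, b, c) \<in> K" for a b c
      proof -
        have "a + c = (a - \<lfloor>a / g1\<rfloor> * g1) + (c - \<lfloor>a / g1\<rfloor> * g3) + \<lfloor>a / g1\<rfloor> * (g1 + g3)"
          by (simp add: algebra_simps)
        then show ?thesis using gen[OF that] 2 by (metis Ints_add Ints_of_int mult.right_neutral)
      qed
      then show ?thesis by auto
    next
      case 3
      have "b + c \<in> \<int>" if "(a, b, c) \<in> K" for a b c
      proof -
        have "b + c = (b - \<lfloor>a / g1\<rfloor> * g2) + (c - \<lfloor>a / g1\<rfloor> * g3) + \<lfloor>a / g1\<rfloor> * (g2 + g3)"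
          by (simp add: algebra_simps)
        then show ?thesis using gen[OF that] 3 by (metis Ints_add Ints_of_int mult.right_neutral)
      qed
      then show ?thesis by auto
    qed
  qed
qed

section \<open>Triangulating a slab\<close>

text \<open>
  The coefficients of the nonzero lattice points in the half-open parallelepiped of a triple.
\<close>

definition box_coeffs :: "'a::real_vector set \<Rightarrow> 'a \<Rightarrow> 'a \<Rightarrow> 'a \<Rightarrow> (real \<times> real \<times> real) set" where
  "box_coeffs \<Gamma> x y c =
     {(u, v, w). u *\<^sub>R x + v *\<^sub>R y + w *\<^sub>R c \<in> \<Gamma>} \<inter> unit_cube - {0}"

definition nat_comb3 :: "'a::real_vector set \<Rightarrow> 'a \<Rightarrow> bool" where
  "nat_comb3 S z \<longleftrightarrow> (\<exists>s1\<in>S. \<exists>s2\<in>S. \<exists>s3\<in>S. \<exists>n1 n2 n3 :: nat.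
     z = of_nat n1 *\<^sub>R s1 + of_nat n2 *\<^sub>R s2 + of_nat n3 *\<^sub>R s3)"

lemma nat_comb3_card:
  fixes x :: "'a::real_vector"
  assumes "nat_comb3 S x"
  shows "\<exists>T\<subseteq>S. card T \<le> 3 \<and> (\<exists>m :: 'a \<Rightarrow> nat. x = (\<Sum>t\<in>T. of_nat (m t) *\<^sub>R t))"
proof -
  obtain s1 s2 s3 and n1 n2 n3 :: nat where s: "s1 \<in> S" "s2 \<in> S" "s3 \<in> S"
    and x: "x = of_nat n1 *\<^sub>R s1 + of_nat n2 *\<^sub>R s2 + of_nat n3 *\<^sub>R s3"
    using assms by (auto simp: nat_comb3_def)
  let ?T = "{s1, s2, s3}"
  define i where "i n s t = (if t = s then n else 0)" for n :: nat and s t :: 'a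
  have i: "(\<Sum>t\<in>?T. of_nat (i n s t) *\<^sub>R t) = of_nat n *\<^sub>R s" if "s \<in> ?T" for n s
  proof -
    have "(\<Sum>t\<in>?T. of_nat (i n s t) *\<^sub>R t) = (\<Sum>t\<in>?T. if t = s then of_nat n *\<^sub>R t else 0)"
      by (intro sum.cong) (auto simp: i_def)
    then show ?thesis using that by (simp only: sum.delta finite.intros if_True)
  qed
  have "x = (\<Sum>t\<in>?T. of_nat (i n1 s1 t + i n2 s2 t + i n3 s3 t) *\<^sub>R t)"
    unfolding x of_nat_add scaleR_add_left sum.distrib by (subst (1 2 3) i) auto
  moreover have "card ?T \<le> 3" by (simp add: card_insert_if)
  moreover have "?T \<subseteq> S" using s by simp
  ultimately show ?thesis by (intro exI[of _ ?T] conjI exI[of _ "\<lambda>t. i n1 s1 t + i n2 s2 t + i n3 s3 t"])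
qed

locale additive_group_in =
  fixes \<Gamma> :: "'a::real_vector set"
  assumes diff_mem: "p \<in> \<Gamma> \<Longrightarrow> q \<in> \<Gamma> \<Longrightarrow> p - q \<in> \<Gamma>" and zero_mem: "0 \<in> \<Gamma>"
begin

lemma uminus_mem: "p \<in> \<Gamma> \<Longrightarrow> - p \<in> \<Gamma>"
  using diff_mem[OF zero_mem] by simp

lemma add_mem: "p \<in> \<Gamma> \<Longrightarrow> q \<in> \<Gamma> \<Longrightarrow> p + q \<in> \<Gamma>"
  using diff_mem[of p "- q"] uminus_mem by simp

lemma sum_mem: "(\<And>i. i \<in> I \<Longrightarrow> f i \<in> \<Gamma>) \<Longrightarrow> sum f I \<in> \<Gamma>"
  by (induction I rule: infinite_finite_induct) (auto simp: zero_mem add_mem)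

lemma of_nat_mem: "p \<in> \<Gamma> \<Longrightarrow> of_nat n *\<^sub>R p \<in> \<Gamma>"
  by (induction n) (auto simp: zero_mem algebra_simps intro: add_mem)

lemma of_int_mem:
  assumes "p \<in> \<Gamma>" shows "of_int n *\<^sub>R p \<in> \<Gamma>"
proof (cases "0 \<le> n")
  case True then show ?thesis using of_nat_mem[OF assms, of "nat n"] by simp
next
  case False then show ?thesis using uminus_mem[OF of_nat_mem[OF assms, of "nat (- n)"]] by simp
qed

lemma Ints_mem: "p \<in> \<Gamma> \<Longrightarrow> t \<in> \<int> \<Longrightarrow> t *\<^sub>R p \<in> \<Gamma>"
  by (auto elim!: Ints_cases intro: of_int_mem)

lemma frac_box:
  assumes "x \<in> \<Gamma>" "y \<in> \<Gamma>" "c \<in> \<Gamma>" "u *\<^sub>R x + v *\<^sub>R y + w *\<^sub>R c \<in> \<Gamma>"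
  shows "(frac u, frac v, frac w) \<in> box_coeffs \<Gamma> x y c \<or> u \<in> \<int> \<and> v \<in> \<int> \<and> w \<in> \<int>"
proof -
  have "of_int \<lfloor>u\<rfloor> *\<^sub>R x + of_int \<lfloor>v\<rfloor> *\<^sub>R y + of_int \<lfloor>w\<rfloor> *\<^sub>R c \<in> \<Gamma>"
    using assms by (intro add_mem of_int_mem)
  from diff_mem[OF assms(4) this]
  have "frac u *\<^sub>R x + frac v *\<^sub>R y + frac w *\<^sub>R c \<in> \<Gamma>"
    by (simp add: frac_def algebra_simps)
  then show ?thesis using frac_in_unit_cube[of u v w]
    by (auto simp: box_coeffs_def zero_prod_def frac_eq_0_iff)
qed

lemma nat_comb3_if_integral:
  assumes "x \<in> S" "y \<in> S" "c \<in> S" "u \<in> \<int>" "v \<in> \<int>" "w \<in> \<int>" "0 \<le> u" "0 \<le> v" "0 \<le> w"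
  shows "nat_comb3 S (u *\<^sub>R x + v *\<^sub>R y + w *\<^sub>R c)"
proof -
  have "\<exists>n::nat. t = n" if "t \<in> \<int>" "0 \<le> t" for t :: real
    using that by (metis Ints_cases of_int_0_le_iff of_int_of_nat_eq zero_le_imp_eq_int)
  then obtain n1 n2 n3 :: nat where "u = n1" "v = n2" "w = n3" using assms by meson
  then show ?thesis unfolding nat_comb3_def using assms by blast
qed


lemma slab_sum_integral:
  assumes "x \<in> \<Gamma>" "y \<in> \<Gamma>" "c \<in> \<Gamma>"
    and slab: "\<And>u v w. (u, v, w) \<in> box_coeffs \<Gamma> x y c \<Longrightarrow> u + v = 1"
    and p: "u *\<^sub>R x + v *\<^sub>R y + w *\<^sub>R c \<in> \<Gamma>"
  shows "u + v \<in> \<int>"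
proof -
  have "frac u + frac v = 1 \<or> u \<in> \<int> \<and> v \<in> \<int>"
    using frac_box[OF assms(1-3) p] slab by blast
  moreover have "u + v = frac u + frac v + of_int (\<lfloor>u\<rfloor> + \<lfloor>v\<rfloor>)" by (simp add: frac_def)
  ultimately show ?thesis by (metis Ints_1 Ints_add Ints_of_int)
qed

text \<open>
  Reducing modulo the triple keeps a third coefficient in \<open>[0, 1)\<close>, so below the least third
  coefficient \<open>d\<close> of a parallelepiped point only integral combinations of the first two vectors occur.
\<close>

lemma below_lowest_integral:
  assumes "x \<in> \<Gamma>" "y \<in> \<Gamma>" "c \<in> \<Gamma>"
    and low: "\<forall>(u, v, w)\<in>box_coeffs \<Gamma> x y c. d \<le> w"
    and p: "u *\<^sub>R x + v *\<^sub>R y + w *\<^sub>R c \<in> \<Gamma>" "0 \<le> w" "w < d" "d \<le> 1"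
  shows "u \<in> \<int> \<and> v \<in> \<int> \<and> w = 0"
proof -
  have fw: "frac w = w" using p by (intro frac_eq[THEN iffD2]) auto
  then have "(frac u, frac v, frac w) \<notin> box_coeffs \<Gamma> x y c" using low p by force
  then have "u \<in> \<int> \<and> v \<in> \<int> \<and> w \<in> \<int>" using frac_box[OF assms(1-3) p(1)] by blast
  then show ?thesis using fw by (metis frac_eq_0_iff)
qed

text \<open>
  In a slab configuration all parallelepiped points of \<open>x, y, c\<close> have value one under the
  functional, integral on the lattice, that is one on \<open>x\<close> and \<open>y\<close> and zero on \<open>c\<close>. Replacing \<open>x\<close> by the point \<open>g\<close>
  with least coefficient of \<open>c\<close> gives such a configuration again, with a smaller parallelepiped:
  its points are points of the old parallelepiped other than \<open>g\<close>, because a coefficient of \<open>c\<close> of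
  at least one would produce, after subtracting \<open>c\<close>, a point below \<open>g\<close>.
\<close>

lemma slab_subdivide:
  assumes xyc: "x \<in> \<Gamma>" "y \<in> \<Gamma>" "c \<in> \<Gamma>" and fin: "finite (box_coeffs \<Gamma> x y c)"
    and slab: "\<And>u v w. (u, v, w) \<in> box_coeffs \<Gamma> x y c \<Longrightarrow>
      u + v = 1 \<and> 0 < w \<and> u *\<^sub>R x + v *\<^sub>R y + w *\<^sub>R c \<in> S"
    and h: "(a, b, d) \<in> box_coeffs \<Gamma> x y c"
    and low: "\<forall>(u, v, w)\<in>box_coeffs \<Gamma> x y c. d \<le> w"
  defines "g \<equiv> a *\<^sub>R x + b *\<^sub>R y + d *\<^sub>R c"
  shows "finite (box_coeffs \<Gamma> g y c)"
    and "card (box_coeffs \<Gamma> g y c) < card (box_coeffs \<Gamma> x y c)"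
    and "(u, v, w) \<in> box_coeffs \<Gamma> g y c \<Longrightarrow> u + v = 1 \<and> 0 < w \<and> u *\<^sub>R g + v *\<^sub>R y + w *\<^sub>R c \<in> S"
proof -
  let ?f = "\<lambda>(u, v, w). (u * a, u * b + v, u * d + w) :: real \<times> real \<times> real"
  have ab: "a + b = 1" and d: "0 < d" and abd: "a < 1" "b < 1" "d < 1"
    using h slab[OF h] by (auto simp: box_coeffs_def unit_cube_def)
  then have a: "0 < a" and b: "0 < b" by auto
  have slab1: "u + v = 1" if "(u, v, w) \<in> box_coeffs \<Gamma> x y c" for u v w using slab[OF that] by simp
  note low' = below_lowest_integral[OF xyc low _ _ _ less_imp_le[OF abd(3)]]
  have key: "u + v = 1 \<and> 0 < w \<and> (u * a, u * b + v, u * d + w) \<in> box_coeffs \<Gamma> x y c - {(a, b, d)}"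
    if "(u, v, w) \<in> box_coeffs \<Gamma> g y c" for u v w
  proof -
    have uvw: "0 \<le> u" "0 \<le> v" "0 \<le> w" "u < 1" "v < 1" "w < 1" and n0: "u \<noteq> 0 \<or> v \<noteq> 0 \<or> w \<noteq> 0"
      and g\<Gamma>: "u *\<^sub>R g + v *\<^sub>R y + w *\<^sub>R c \<in> \<Gamma>"
      using that by (auto simp: box_coeffs_def unit_cube_def zero_prod_def)
    have p: "(u * a) *\<^sub>R x + (u * b + v) *\<^sub>R y + (u * d + w) *\<^sub>R c \<in> \<Gamma>"
      using g\<Gamma> by (simp add: g_def algebra_simps)
    have ud: "u * d < d" using uvw d by simp
    have "u * a + (u * b + v) \<in> \<int>" using slab_sum_integral[OF xyc slab1 p] .
    moreover have "u * a + (u * b + v) = u + v" using ab by (simp flip: add.assoc distrib_left)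
    ultimately have uv: "u + v = 0 \<or> u + v = 1" using uvw by (auto elim!: Ints_cases)
    have "u + v \<noteq> 0"
    proof
      assume "u + v = 0"
      then have [simp]: "u = 0" "v = 0" using uvw by auto
      then have "(u, v, w) \<in> box_coeffs \<Gamma> x y c"
        using p uvw n0 by (auto simp: box_coeffs_def unit_cube_def zero_prod_def)
      from slab1[OF this] show False by simp
    qed
    then have uv: "u + v = 1" using uv by simp
    then have u: "0 < u" and v: "0 < v" using uvw by auto
    have w: "0 < w"
    proof (rule ccontr)
      assume "\<not> 0 < w"
      then have "w = 0" using uvw by simp
      then show False using low'[OF p] uvw d u ud by simp
    qed
    have x1: "u * a < 1" using mult_strict_mono[of u 1 a 1] uvw abd a by simp
    have y1: "u * b + v < 1" using mult_strict_left_mono[OF abd(2) u] uv by simp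
    have z1: "u * d + w < 1"
    proof (rule ccontr)
      \<comment> \<open>Otherwise subtracting \<open>c\<close> gives a lattice point with third coefficient below \<open>d\<close>.\<close>
      assume *: "\<not> u * d + w < 1"
      have "(u * a) *\<^sub>R x + (u * b + v) *\<^sub>R y + (u * d + w - 1) *\<^sub>R c \<in> \<Gamma>"
        using diff_mem[OF p xyc(3)] by (simp add: algebra_simps)
      then have "u * a \<in> \<int>" using low' * uvw ud by (smt (verit))
      moreover have "0 < u * a" using u a by simp
      ultimately show False using x1 by (auto elim!: Ints_cases)
    qed
    have "(u * a, u * b + v, u * d + w) \<noteq> (a, b, d)" using uvw a by simp
    moreover have "(u * a, u * b + v, u * d + w) \<in> box_coeffs \<Gamma> x y c"
      using p x1 y1 z1 u v w a b d by (auto simp: box_coeffs_def unit_cube_def zero_prod_def)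
    ultimately show ?thesis using uv w by simp
  qed
  have sub: "?f ` box_coeffs \<Gamma> g y c \<subseteq> box_coeffs \<Gamma> x y c - {(a, b, d)}"
  proof (rule image_subsetI)
    fix p assume "p \<in> box_coeffs \<Gamma> g y c"
    then show "?f p \<in> box_coeffs \<Gamma> x y c - {(a, b, d)}"
      using key[of "fst p" "fst (snd p)" "snd (snd p)"] by (simp add: case_prod_unfold)
  qed
  have inj: "inj_on ?f (box_coeffs \<Gamma> g y c)" using a by (auto simp: inj_on_def)
  show "finite (box_coeffs \<Gamma> g y c)" using sub fin inj by (meson finite_Diff finite_imageD finite_subset)
  have "card (box_coeffs \<Gamma> g y c) \<le> card (box_coeffs \<Gamma> x y c - {(a, b, d)})"
    using sub fin inj by (intro card_inj_on_le) auto
  also have "\<dots> < card (box_coeffs \<Gamma> x y c)" using h fin by (intro card_Diff1_less) auto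
  finally show "card (box_coeffs \<Gamma> g y c) < card (box_coeffs \<Gamma> x y c)" .
  assume uvw: "(u, v, w) \<in> box_coeffs \<Gamma> g y c"
  have "u *\<^sub>R g + v *\<^sub>R y + w *\<^sub>R c = (u * a) *\<^sub>R x + (u * b + v) *\<^sub>R y + (u * d + w) *\<^sub>R c"
    by (simp add: g_def algebra_simps)
  then show "u + v = 1 \<and> 0 < w \<and> u *\<^sub>R g + v *\<^sub>R y + w *\<^sub>R c \<in> S"
    using key[OF uvw] slab by auto
qed

lemma box_coeffs_swap: "(v, u, w) \<in> box_coeffs \<Gamma> y x c \<longleftrightarrow> (u, v, w) \<in> box_coeffs \<Gamma> x y c"
  by (auto simp: box_coeffs_def unit_cube_def zero_prod_def add.commute)

lemma bij_betw_box_coeffs_swap: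
  "bij_betw (\<lambda>(u, v, w). (v, u, w)) (box_coeffs \<Gamma> x y c) (box_coeffs \<Gamma> y x c)"
  by (rule bij_betw_byWitness[where f' = "\<lambda>(u, v, w). (v, u, w)"]) (auto simp: box_coeffs_swap)

text \<open>
  The cone over \<open>x, y, c\<close> is the union of the cones over \<open>x, y, g\<close> and \<open>g, y, c\<close> and \<open>x, g, c\<close>, where
  \<open>g\<close> is the lowest parallelepiped point. The first is unimodular, since there is no lattice point
  below \<open>g\<close>, and the other two are smaller slab configurations.
\<close>

lemma slab_nat_comb3:
  assumes "x \<in> \<Gamma>" "y \<in> \<Gamma>" "c \<in> \<Gamma>" "x \<in> S" "y \<in> S" "c \<in> S"
    and "finite (box_coeffs \<Gamma> x y c)"
    and "\<And>u v w. (u, v, w) \<in> box_coeffs \<Gamma> x y c \<Longrightarrow>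
      u + v = 1 \<and> 0 < w \<and> u *\<^sub>R x + v *\<^sub>R y + w *\<^sub>R c \<in> S"
    and "l *\<^sub>R x + m *\<^sub>R y + n *\<^sub>R c \<in> \<Gamma>" "0 \<le> l" "0 \<le> m" "0 \<le> n"
  shows "nat_comb3 S (l *\<^sub>R x + m *\<^sub>R y + n *\<^sub>R c)"
  using assms
proof (induction "card (box_coeffs \<Gamma> x y c)" arbitrary: x y l m n rule: less_induct)
  case less
  note xyc = less.prems(1-6) and fin = less.prems(7) and slab = less.prems(8) and z = less.prems(9-12)
  let ?B = "box_coeffs \<Gamma> x y c"
  show ?case
  proof (cases "?B = {}")
    case True
    then have "l \<in> \<int> \<and> m \<in> \<int> \<and> n \<in> \<int>" using frac_box[OF xyc(1-3) z(1)] by auto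
    then show ?thesis using xyc z by (intro nat_comb3_if_integral) auto
  next
    case False
    define h where "h = arg_min_on (\<lambda>(u, v, w). w) ?B"
    obtain a b d where h_eq: "h = (a, b, d)" by (cases h)
    have h: "(a, b, d) \<in> ?B" and hmin: "\<forall>(u, v, w)\<in>?B. d \<le> w"
      using arg_min_if_finite(1)[OF fin False, of "\<lambda>(u, v, w). w"]
        arg_min_least[OF fin False, of _ "\<lambda>(u, v, w). w"]
      unfolding h_def[symmetric] h_eq by auto
    define g where "g = a *\<^sub>R x + b *\<^sub>R y + d *\<^sub>R c"
    have ab: "a + b = 1" and d: "0 < d" and gS: "g \<in> S" using slab[OF h] by (auto simp: g_def)
    have abd: "a < 1" "b < 1" "d < 1" and g\<Gamma>: "g \<in> \<Gamma>"
      using h by (auto simp: box_coeffs_def unit_cube_def g_def)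
    have a: "0 < a" and b: "0 < b" using ab abd by auto
    consider (bottom) "n / d \<le> l / a" "n / d \<le> m / b"
      | (left) "l / a \<le> n / d" "l / a \<le> m / b" | (right) "m / b \<le> n / d" "m / b \<le> l / a"
      by linarith
    then show ?thesis
    proof cases
      case bottom
      define t where "t = n / d"
      have t: "0 \<le> t" "t * a \<le> l" "t * b \<le> m" "t * d = n"
        using bottom a b d z by (auto simp: t_def field_simps)
      have eq: "l *\<^sub>R x + m *\<^sub>R y + n *\<^sub>R c = (l - t * a) *\<^sub>R x + (m - t * b) *\<^sub>R y + t *\<^sub>R g"
        unfolding t(4)[symmetric] g_def by (simp add: algebra_simps)
      have "box_coeffs \<Gamma> x y g = {}"
      proof safe
        fix u v w assume "(u, v, w) \<in> box_coeffs \<Gamma> x y g"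
        then have p: "u *\<^sub>R x + v *\<^sub>R y + w *\<^sub>R g \<in> \<Gamma>" "(u, v, w) \<in> unit_cube" "(u, v, w) \<noteq> 0"
          by (auto simp: box_coeffs_def)
        have "(u + w * a) *\<^sub>R x + (v + w * b) *\<^sub>R y + (w * d) *\<^sub>R c \<in> \<Gamma>"
          using p(1) by (simp add: g_def algebra_simps)
        then have "u + w * a \<in> \<int> \<and> v + w * b \<in> \<int> \<and> w * d = 0"
          by (rule below_lowest_integral[OF xyc(1-3) hmin])
            (use p d abd in \<open>auto simp: unit_cube_def\<close>)
        then have "w = 0" "u \<in> \<int>" "v \<in> \<int>" using d by auto
        then show "(u, v, w) \<in> {}" using p by (auto simp: unit_cube_def zero_prod_def elim!: Ints_cases)
      qed
      then have "l - t * a \<in> \<int> \<and> m - t * b \<in> \<int> \<and> t \<in> \<int>"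
        using frac_box[OF xyc(1,2) g\<Gamma> z(1)[unfolded eq]] by auto
      then show ?thesis unfolding eq using t xyc gS by (intro nat_comb3_if_integral) auto
    next
      case left
      define t where "t = l / a"
      have t: "0 \<le> t" "t * a = l" "t * b \<le> m" "t * d \<le> n"
        using left a b d z by (auto simp: t_def field_simps)
      have eq: "l *\<^sub>R x + m *\<^sub>R y + n *\<^sub>R c = t *\<^sub>R g + (m - t * b) *\<^sub>R y + (n - t * d) *\<^sub>R c"
        unfolding t(2)[symmetric] g_def by (simp add: algebra_simps)
      note sub = slab_subdivide[OF xyc(1-3) fin slab h hmin, folded g_def]
      show ?thesis
        unfolding eq using t z(1)[unfolded eq] sub(3)
        by (intro less.hyps[OF sub(2) g\<Gamma> xyc(2,3) gS xyc(5,6) sub(1)]) auto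
    next
      case right
      define t where "t = m / b"
      have t: "0 \<le> t" "t * a \<le> l" "t * b = m" "t * d \<le> n"
        using right a b d z by (auto simp: t_def field_simps)
      have eq: "l *\<^sub>R x + m *\<^sub>R y + n *\<^sub>R c = t *\<^sub>R g + (l - t * a) *\<^sub>R x + (n - t * d) *\<^sub>R c"
        unfolding t(3)[symmetric] g_def by (simp add: algebra_simps)
      have g': "g = b *\<^sub>R y + a *\<^sub>R x + d *\<^sub>R c" by (simp add: g_def)
      have swap: "finite (box_coeffs \<Gamma> y x c)" "(b, a, d) \<in> box_coeffs \<Gamma> y x c"
        "\<forall>(u, v, w)\<in>box_coeffs \<Gamma> y x c. d \<le> w"
        using fin h hmin bij_betw_finite[OF bij_betw_box_coeffs_swap[of x y c]]
        by (auto simp: box_coeffs_swap[of _ _ _ y x])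
      have slab': "u + v = 1 \<and> 0 < w \<and> u *\<^sub>R y + v *\<^sub>R x + w *\<^sub>R c \<in> S"
        if "(u, v, w) \<in> box_coeffs \<Gamma> y x c" for u v w
        using that slab[of v u w] by (simp add: box_coeffs_swap[of _ _ _ y x] add.commute)
      note sub = slab_subdivide[OF xyc(2,1,3) swap(1) slab' swap(2,3), folded g']
      show ?thesis
        unfolding eq using t z(1)[unfolded eq] sub(3)
        by (intro less.hyps[OF sub(2)[folded bij_betw_same_card[OF bij_betw_box_coeffs_swap[of x y c]]] g\<Gamma> xyc(1,3) gS xyc(4,6) sub(1)]) auto
    qed
  qed
qed

end

section \<open>The integral Caratheodory property in dimension three\<close>

text \<open>
  Finitely many vectors that generate the monoid of lattice points of their real cone, as a Hilbert
  basis does. The functional \<open>f\<close> witnesses that the cone is pointed.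
\<close>

locale cone_generators = additive_group_in \<Gamma> for \<Gamma> :: "'a::euclidean_space set" +
  fixes S :: "'a set" and f :: "'a \<Rightarrow> real"
  assumes finite_S: "finite S" and S_sub: "S \<subseteq> \<Gamma>"
    and f_linear: "linear f" and f_pos: "s \<in> S \<Longrightarrow> 0 < f s"
    and generates: "(\<And>s. s \<in> S \<Longrightarrow> 0 \<le> l s) \<Longrightarrow> (\<Sum>s\<in>S. l s *\<^sub>R s) \<in> \<Gamma> \<Longrightarrow>
      \<exists>m :: 'a \<Rightarrow> nat. (\<Sum>s\<in>S. l s *\<^sub>R s) = (\<Sum>s\<in>S. of_nat (m s) *\<^sub>R s)"
begin

definition comb :: "('a \<Rightarrow> real) \<Rightarrow> 'a" where
  "comb l = (\<Sum>s\<in>S. l s *\<^sub>R s)"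

definition weight :: "('a \<Rightarrow> real) \<Rightarrow> real" where
  "weight l = (\<Sum>s\<in>S. l s)"

definition energy :: "('a \<Rightarrow> real) \<Rightarrow> real" where
  "energy l = (\<Sum>s\<in>S. l s * (s \<bullet> s))"

definition support :: "('a \<Rightarrow> real) \<Rightarrow> 'a set" where
  "support l = {s. l s \<noteq> 0}"

definition nonneg_reps :: "'a \<Rightarrow> ('a \<Rightarrow> real) set" where
  "nonneg_reps x = {l. (\<forall>s. 0 \<le> l s) \<and> support l \<subseteq> S \<and> comb l = x}"

text \<open>
  The lexicographic order on weight and negative energy. The second component breaks ties between
  representations of equal weight so that an optimal support contains all lattice points of the
  simplex it spans.
\<close>

definition no_better :: "('a \<Rightarrow> real) \<Rightarrow> ('a \<Rightarrow> real) \<Rightarrow> bool" where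
  "no_better l l' \<longleftrightarrow> weight l < weight l' \<or> weight l = weight l' \<and> energy l' \<le> energy l"

lemma no_better_trans: "no_better l l' \<Longrightarrow> no_better l' l'' \<Longrightarrow> no_better l l''"
  by (auto simp: no_better_def)

lemma
  shows comb_add: "comb (\<lambda>s. l s + t * m s) = comb l + t *\<^sub>R comb m"
    and weight_add: "weight (\<lambda>s. l s + t * m s) = weight l + t * weight m"
    and energy_add: "energy (\<lambda>s. l s + t * m s) = energy l + t * energy m"
  by (simp_all add: comb_def weight_def energy_def sum.distrib algebra_simps scaleR_sum_right sum_distrib_left)

lemma support_outside: "support l \<subseteq> A \<Longrightarrow> s \<notin> A \<Longrightarrow> l s = 0"
  by (auto simp: support_def)

lemma comb_on_support:
  assumes "support l \<subseteq> A" "A \<subseteq> S"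
  shows "comb l = (\<Sum>s\<in>A. l s *\<^sub>R s)" "weight l = (\<Sum>s\<in>A. l s)" "energy l = (\<Sum>s\<in>A. l s * (s \<bullet> s))"
  unfolding comb_def weight_def energy_def
  by (rule sum.mono_neutral_right; use assms finite_S in \<open>auto simp: support_def\<close>)+

lemma f_comb: "f (comb l) = (\<Sum>s\<in>S. l s * f s)"
  by (simp add: comb_def linear_sum[OF f_linear] linear_scale[OF f_linear])

lemma f_comb_pos:
  assumes "\<And>s. 0 \<le> l s" "support l \<subseteq> S" "support l \<noteq> {}"
  shows "0 < f (comb l)"
proof -
  obtain s where s: "s \<in> S" "l s \<noteq> 0" using assms by (auto simp: support_def)
  then have "0 < l s * f s" using assms(1)[of s] f_pos by simp
  then show ?thesis unfolding f_comb
    using s assms(1) f_pos finite_S by (intro sum_pos2[of S s]) (auto simp: less_imp_le)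
qed

text \<open>
  Moving along a linear relation of the support, in the direction in which the objective does not
  deteriorate, until a coefficient vanishes. Such a coefficient exists because the cone is pointed,
  so that a nontrivial relation has coefficients of both signs.
\<close>

lemma support_reduction:
  assumes "l \<in> nonneg_reps x"
  shows "\<exists>l'\<in>nonneg_reps x. independent (support l') \<and> no_better l l'"
  using assms
proof (induction "card (support l)" arbitrary: l rule: less_induct)
  case less
  have l: "\<And>s. 0 \<le> l s" "support l \<subseteq> S" "comb l = x" using less.prems by (auto simp: nonneg_reps_def)
  show ?case
  proof (cases "independent (support l)")
    case True then show ?thesis using less.prems by (auto simp: no_better_def)
  next
    case False
    have fin: "finite (support l)" using l finite_S by (auto intro: finite_subset)
    obtain u v where u: "v \<in> support l" "u v \<noteq> 0" "(\<Sum>s\<in>support l. u s *\<^sub>R s) = 0"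
      using False dependent_finite[OF fin] by blast
    define m0 where "m0 s = (if s \<in> support l then u s else 0)" for s
    have m0: "support m0 \<subseteq> support l" "support m0 \<noteq> {}"
      using u by (auto simp: support_def m0_def split: if_splits)
    have m0c: "comb m0 = 0"
      using u comb_on_support(1)[OF m0(1) l(2)] by (simp add: m0_def)
    define m where "m = (if weight m0 < 0 \<or> weight m0 = 0 \<and> 0 \<le> energy m0 then m0 else (\<lambda>s. - m0 s))"
    have sm: "support (\<lambda>s. - m0 s) = support m0" by (simp add: support_def)
    have m: "support m \<subseteq> support l" "support m \<noteq> {}" "comb m = 0"
      "weight m < 0 \<or> weight m = 0 \<and> 0 \<le> energy m"
      using m0 m0c by (auto simp: m_def sm) (auto simp: comb_def weight_def energy_def sum_negf)
    define P where "P = {s \<in> support l. 0 < m s}"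
    have finP: "finite P" using fin by (auto simp: P_def)
    have "P \<noteq> {}"
    proof
      assume "P = {}"
      have "0 < f (comb (\<lambda>s. 0 + (-1) * m s))"
      proof (rule f_comb_pos)
        show "0 \<le> 0 + - 1 * m s" for s
          using \<open>P = {}\<close> m(1) by (cases "m s = 0") (auto simp: P_def support_def subset_iff not_less)
      qed (use m(1,2) l(2) in \<open>auto simp: support_def\<close>)
      then show False unfolding comb_add using m(3) by (simp add: comb_def linear_0[OF f_linear])
    qed
    define t where "t = Min ((\<lambda>s. l s / m s) ` P)"
    have "t \<in> (\<lambda>s. l s / m s) ` P" unfolding t_def using finP \<open>P \<noteq> {}\<close> by (intro Min_in) auto
    then obtain b where b: "b \<in> P" "t = l b / m b" by blast
    have tle: "t \<le> l s / m s" if "s \<in> P" for s unfolding t_def using finP that by (intro Min_le) auto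
    have t0: "0 \<le> t" using b l by (auto simp: P_def)
    define l' where "l' = (\<lambda>s. l s + (- t) * m s)"
    have nn: "0 \<le> l' s" for s
    proof (cases "s \<in> P")
      case True then show ?thesis using tle[OF True] by (auto simp: l'_def P_def field_simps)
    next
      case False
      then have "m s \<le> 0" using m(1) by (force simp: P_def support_def)
      then show ?thesis using mult_nonneg_nonpos[OF t0, of "m s"] l(1)[of s] by (simp add: l'_def)
    qed
    have "support l' \<subseteq> support l" using m(1) by (auto simp: l'_def support_def)
    moreover have "b \<in> support l" "b \<notin> support l'" using b by (auto simp: l'_def support_def P_def)
    ultimately have sub: "support l' \<subset> support l" by auto
    have "comb l' = x" unfolding l'_def comb_add using l m by simp
    then have "l' \<in> nonneg_reps x" using nn sub l by (auto simp: nonneg_reps_def)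
    then obtain l'' where l'': "l'' \<in> nonneg_reps x" "independent (support l'')" "no_better l' l''"
      using less.hyps psubset_card_mono[OF fin sub] by blast
    have "no_better l l'"
      using t0 m(4) unfolding no_better_def l'_def weight_add energy_add
      by (cases "t = 0") (auto simp: mult_less_0_iff)
    then show ?thesis using l'' no_better_trans by blast
  qed
qed

lemma comb_unique:
  assumes "independent B" "B \<subseteq> S" "support l \<subseteq> B" "support m \<subseteq> B" "comb l = comb m"
  shows "l = m"
proof
  fix s
  have "(\<Sum>s\<in>B. (l s - m s) *\<^sub>R s) = 0"
    using assms comb_on_support(1)[of l B] comb_on_support(1)[of m B]
    by (simp add: scaleR_diff_left sum_subtractf)
  moreover have "finite B" using assms finite_S by (auto intro: finite_subset)
  ultimately have "l s - m s = 0" if "s \<in> B" using assms(1) that by (auto dest!: independentD)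
  then show "l s = m s" using assms(3,4) by (cases "s \<in> B") (auto simp: support_outside)
qed

text \<open>
  Representations with independent support are determined by their support, so there are finitely
  many of them, and the reduction lemma extends optimality among them to all representations.
\<close>

lemma optimal_rep_exists:
  assumes "nonneg_reps x \<noteq> {}"
  shows "\<exists>l\<in>nonneg_reps x. independent (support l) \<and> (\<forall>l'\<in>nonneg_reps x. no_better l' l)"
proof -
  define A where "A = {l \<in> nonneg_reps x. independent (support l)}"
  have "inj_on support A"
  proof (rule inj_onI)
    fix l m assume "l \<in> A" "m \<in> A" "support l = support m"
    then show "l = m" by (intro comb_unique[of "support l"]) (auto simp: A_def nonneg_reps_def)
  qed
  moreover have "support ` A \<subseteq> Pow S" by (auto simp: A_def nonneg_reps_def)
  ultimately have finA: "finite A" using finite_S by (meson finite_Pow_iff finite_imageD finite_subset)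
  have "A \<noteq> {}" using assms support_reduction by (auto simp: A_def)
  define A' where "A' = {l \<in> A. weight l = Max (weight ` A)}"
  have "Max (weight ` A) \<in> weight ` A" using finA \<open>A \<noteq> {}\<close> by (intro Max_in) auto
  then have A': "finite A'" "A' \<noteq> {}" using finA by (auto simp: A'_def)
  define l where "l = arg_min_on energy A'"
  have l: "l \<in> A'" "\<And>m. m \<in> A' \<Longrightarrow> energy l \<le> energy m"
    using arg_min_if_finite(1)[OF A', of energy] arg_min_least[OF A', of _ energy] by (auto simp: l_def)
  have best: "no_better m l" if "m \<in> A" for m
  proof -
    have "weight m \<le> weight l" using l(1) that finA by (auto simp: A'_def)
    then show ?thesis using l that by (auto simp: no_better_def A'_def)
  qed
  show ?thesis
  proof (intro bexI[of _ l] conjI ballI)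
    fix m assume "m \<in> nonneg_reps x"
    then obtain m' where "m' \<in> A" "no_better m m'" using support_reduction by (auto simp: A_def)
    then show "no_better m l" using best no_better_trans by blast
  qed (use l in \<open>auto simp: A'_def A_def\<close>)
qed

context
  fixes x l
  assumes l_rep: "l \<in> nonneg_reps x" and indep: "independent (support l)"
    and best: "\<forall>l'\<in>nonneg_reps x. no_better l' l"
begin

lemma l_props: "0 \<le> l s" "support l \<subseteq> S" "comb l = x"
  using l_rep by (auto simp: nonneg_reps_def)

lemma finite_support: "finite (support l)"
  using l_props finite_S by (auto intro: finite_subset)

text \<open>
  A lattice point in the cone over the optimal support is a natural combination of generators; moving
  the optimal representation a little from its real to its natural representation shows that the
  natural one is no better.
\<close>

lemma natural_rep:
  assumes b: "\<And>s. 0 \<le> b s" "support b \<subseteq> support l" and p: "comb b \<in> \<Gamma>"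
  shows "\<exists>m :: 'a \<Rightarrow> nat. comb b = comb (\<lambda>s. of_nat (m s)) \<and> no_better (\<lambda>s. of_nat (m s)) b"
proof -
  obtain m0 :: "'a \<Rightarrow> nat" where m0: "comb b = (\<Sum>s\<in>S. of_nat (m0 s) *\<^sub>R s)"
    using generates[of b] b(1) p by (auto simp: comb_def)
  define m where "m s = (if s \<in> S then m0 s else 0)" for s
  have m: "comb b = comb (\<lambda>s. of_nat (m s))" unfolding m0 by (simp add: comb_def m_def)
  have ms: "support (\<lambda>s. of_nat (m s)) \<subseteq> S" by (auto simp: support_def m_def)
  \<comment> \<open>Any positive step that keeps the coefficients nonnegative; the summand 1 avoids a zero denominator.\<close>
  define t where "t = Min (insert 1 ((\<lambda>s. l s / (b s + 1)) ` support l))"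
  have fin: "finite (insert 1 ((\<lambda>s. l s / (b s + 1)) ` support l))" using finite_support by simp
  have "0 < l s / (b s + 1)" if "s \<in> support l" for s
    using that b(1)[of s] l_props(1)[of s] by (auto simp: support_def intro!: divide_pos_pos)
  then have t0: "0 < t" using fin by (auto simp: t_def)
  have tb: "t * b s \<le> l s" if "s \<in> support l" for s
  proof -
    have "t \<le> l s / (b s + 1)" using that fin by (auto simp: t_def)
    then have "t * (b s + 1) \<le> l s" using b(1)[of s] by (simp add: pos_le_divide_eq)
    then show ?thesis using t0 by (simp add: algebra_simps)
  qed
  define l' where "l' = (\<lambda>s. (l s + (- t) * b s) + t * of_nat (m s))"
  have "0 \<le> l' s" for s
  proof (cases "s \<in> support l")
    case True then show ?thesis using tb[OF True] t0 by (auto simp: l'_def)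
  next
    case False
    then have "b s = 0" using b(2) by (auto simp: support_def)
    then show ?thesis using l_props t0 by (simp add: l'_def)
  qed
  moreover have "support l' \<subseteq> S" 
  proof (rule subsetI, rule ccontr)
    fix s assume "s \<in> support l'" "s \<notin> S"
    then show False
      using support_outside[OF ms] support_outside[OF l_props(2)] support_outside[OF subset_trans[OF b(2) l_props(2)]]
      by (simp add: l'_def support_def)
  qed
  moreover have "comb l' = x" unfolding l'_def comb_add using m l_props by simp
  ultimately have "l' \<in> nonneg_reps x" by (auto simp: nonneg_reps_def)
  from best[rule_format, OF this] have "no_better (\<lambda>s. of_nat (m s)) b"
    unfolding no_better_def l'_def weight_add energy_add using t0 by (auto simp: algebra_simps)
  then show ?thesis using m by blast
qed

lemma weight_nat_ge_1:
  assumes "comb (\<lambda>s. of_nat (m s)) \<noteq> 0" shows "1 \<le> weight (\<lambda>s. of_nat (m s))"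
proof (rule ccontr)
  assume "\<not> ?thesis"
  then have "(\<Sum>s\<in>S. m s) = 0" by (simp add: weight_def flip: of_nat_sum)
  then have "\<forall>s\<in>S. m s = 0" using finite_S by simp
  then show False using assms by (simp add: comb_def)
qed

lemma weight_nat_eq_1:
  assumes "weight (\<lambda>s. of_nat (m s)) = 1"
  shows "\<exists>s\<in>S. comb (\<lambda>s. of_nat (m s)) = s \<and> energy (\<lambda>s. of_nat (m s)) = s \<bullet> s"
proof -
  have 1: "(\<Sum>s\<in>S. m s) = 1" using assms by (simp add: weight_def flip: of_nat_sum)
  then obtain s where s: "s \<in> S" "m s \<noteq> 0" by (metis sum.neutral zero_neq_one)
  have "(\<Sum>s\<in>S. m s) = m s + (\<Sum>s\<in>S - {s}. m s)" using s finite_S by (simp add: sum.remove)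
  then have "m s = 1" "(\<Sum>s\<in>S - {s}. m s) = 0" using 1 s by auto
  then have m: "m r = (if r = s then 1 else 0)" if "r \<in> S" for r using that finite_S by auto
  have "comb (\<lambda>s. of_nat (m s)) = (\<Sum>r\<in>S. if r = s then r else 0)"
    unfolding comb_def by (intro sum.cong) (auto simp: m)
  moreover have "energy (\<lambda>s. of_nat (m s)) = (\<Sum>r\<in>S. if r = s then r \<bullet> r else 0)"
    unfolding energy_def by (intro sum.cong) (auto simp: m)
  ultimately show ?thesis using s finite_S by auto
qed

text \<open>
  The natural representation has integral weight at least one and at most the weight of \<open>b\<close>, so below
  weight two the point is a generator \<open>q\<close>. In weight one, comparing energies gives
  \<open>q \<bullet> q \<ge> energy b\<close>, and strict convexity of the squared norm leaves only the vertices.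
\<close>

lemma light_lattice_point:
  assumes b: "\<And>s. 0 \<le> b s" "support b \<subseteq> support l" "support b \<noteq> {}" and p: "comb b \<in> \<Gamma>"
  shows "1 \<le> weight b" "weight b < 2 \<Longrightarrow> comb b \<in> S" "weight b = 1 \<Longrightarrow> comb b \<in> support l"
proof -
  have nz: "comb b \<noteq> 0" using f_comb_pos[of b] b l_props(2) linear_0[OF f_linear] by force
  obtain m :: "'a \<Rightarrow> nat" where m: "comb b = comb (\<lambda>s. of_nat (m s))" "no_better (\<lambda>s. of_nat (m s)) b"
    using natural_rep[OF b(1,2) p] by blast
  have 1: "1 \<le> weight (\<lambda>s. of_nat (m s))" using weight_nat_ge_1 nz m by simp
  then show "1 \<le> weight b" using m(2) by (auto simp: no_better_def)
  have int: "weight (\<lambda>s. of_nat (m s)) \<in> \<int>" unfolding weight_def by (intro Ints_sum) simp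
  have eq1: "weight (\<lambda>s. of_nat (m s)) = 1" if "weight b < 2"
    using 1 int that m(2) by (auto simp: no_better_def elim!: Ints_cases)
  then show "weight b < 2 \<Longrightarrow> comb b \<in> S" using weight_nat_eq_1[of m] m by auto
  assume w1: "weight b = 1"
  then obtain q where q: "q \<in> S" "comb b = q" "energy (\<lambda>s. of_nat (m s)) = q \<bullet> q"
    using weight_nat_eq_1[of m] m eq1 by auto
  then have en: "energy b \<le> q \<bullet> q" using m(2) eq1 w1 by (auto simp: no_better_def)
  have "(\<Sum>s\<in>S. b s * ((s - q) \<bullet> (s - q))) = energy b - 2 * (comb b \<bullet> q) + weight b * (q \<bullet> q)"
  proof -
    have "comb b \<bullet> q = (\<Sum>s\<in>S. b s * (s \<bullet> q))" by (simp add: comb_def inner_sum_left)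
    then show ?thesis unfolding energy_def weight_def
      by (simp add: inner_diff_left inner_diff_right sum_distrib_left sum_distrib_right
        algebra_simps sum.distrib sum_subtractf inner_commute)
  qed
  also have "\<dots> \<le> 0" using q w1 en by simp
  finally have "(\<Sum>s\<in>S. b s * ((s - q) \<bullet> (s - q))) = 0"
    using b(1) by (intro antisym sum_nonneg) auto
  then have "\<forall>s\<in>S. b s * ((s - q) \<bullet> (s - q)) = 0"
    using b(1) finite_S by (subst (asm) sum_nonneg_eq_0_iff) auto
  moreover obtain s where "b s \<noteq> 0" "s \<in> support l" using b by (auto simp: support_def)
  ultimately have "s = q" "s \<in> support l" using l_props(2) by auto
  then show "comb b \<in> support l" using q by simp
qed

lemma box_point_heavy:
  assumes b: "\<And>s. 0 \<le> b s" "\<And>s. b s < 1" "support b \<subseteq> support l" "support b \<noteq> {}" and p: "comb b \<in> \<Gamma>"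
  shows "1 < weight b"
proof (rule ccontr)
  assume "\<not> 1 < weight b"
  then have "weight b = 1" using light_lattice_point(1)[OF b(1,3,4) p] by simp
  then have q: "comb b \<in> support l" using light_lattice_point(3)[OF b(1,3,4) p] by simp
  define i where "i s = (if s = comb b then 1 else 0 :: real)" for s
  have "comb i = (\<Sum>s\<in>S. if s = comb b then s else 0)" unfolding comb_def[of i]
    by (intro sum.cong) (auto simp: i_def)
  also have "\<dots> = comb b" using q l_props(2) finite_S by auto
  finally have "b = i" using indep l_props(2) b q
    by (intro comb_unique[of "support l"]) (auto simp: support_def i_def split: if_splits)
  then have "b (comb b) = 1" by (metis i_def)
  then show False using b(2)[of "comb b"] by simp
qed

text \<open>
  A parallelepiped point and its complement both have weight greater than one, and these weights add
  up to the number of vectors involved, which is therefore at least three.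
\<close>

lemma box_point:
  assumes b: "\<And>s. 0 \<le> b s" "\<And>s. b s < 1" "support b \<subseteq> support l" "support b \<noteq> {}" and p: "comb b \<in> \<Gamma>"
    and dim: "card (support l) \<le> 3"
  shows "card (support l) = 3" "support b = support l" "1 < weight b" "weight b < 2" "comb b \<in> S"
proof -
  define b' where "b' s = (if s \<in> support b then 1 - b s else 0)" for s
  have b': "0 \<le> b' s" "b' s < 1" "support b' = support b" for s
    using b(1)[of s] less_imp_le[OF b(2)[of s]] less_imp_neq[OF b(2)]
    by (auto simp: b'_def support_def)
  have sub: "support b \<subseteq> S" using b l_props by auto
  have "comb b' = (\<Sum>s\<in>support b. s) - comb b"
    using comb_on_support(1)[of b' "support b"] comb_on_support(1)[of b "support b"] sub b'(3)
    by (simp add: b'_def scaleR_diff_left sum_subtractf)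
  moreover have "\<dots> \<in> \<Gamma>" using p sub S_sub by (intro diff_mem sum_mem) auto
  ultimately have w': "1 < weight b'" using box_point_heavy[of b'] b' b by simp
  have w: "1 < weight b" using box_point_heavy b p by blast
  have "weight b' = card (support b) - weight b"
    using comb_on_support(2)[of b' "support b"] comb_on_support(2)[of b "support b"] sub b'(3)
    by (simp add: b'_def sum_subtractf)
  moreover have c: "card (support b) \<le> card (support l)" using b(3) finite_support by (rule card_mono[rotated])
  ultimately have "2 < card (support b)" using w w' by linarith
  then show c3: "card (support l) = 3" using c dim by simp
  show "support b = support l" using \<open>2 < card (support b)\<close> dim b(3) finite_support
    by (intro card_seteq) auto
  then show "1 < weight b" "weight b < 2" using w w' c3 \<open>weight b' = _\<close> by auto
  then show "comb b \<in> S" using light_lattice_point(2) b p by blast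
qed

lemma box_coeffs_of_support:
  assumes B: "support l = {a, b, c}" "a \<noteq> b" "a \<noteq> c" "b \<noteq> c"
    and uvw: "(u, v, w) \<in> box_coeffs \<Gamma> a b c"
  shows "0 < u \<and> 0 < v \<and> 0 < w \<and> 1 < u + v + w \<and> u + v + w < 2 \<and> u *\<^sub>R a + v *\<^sub>R b + w *\<^sub>R c \<in> S"
proof -
  define q where "q s = (if s = a then u else if s = b then v else if s = c then w else 0)" for s
  have cube: "0 \<le> u" "0 \<le> v" "0 \<le> w" "u < 1" "v < 1" "w < 1" "u \<noteq> 0 \<or> v \<noteq> 0 \<or> w \<noteq> 0"
    and p: "u *\<^sub>R a + v *\<^sub>R b + w *\<^sub>R c \<in> \<Gamma>"
    using uvw by (auto simp: box_coeffs_def unit_cube_def zero_prod_def)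
  have sub: "support q \<subseteq> {a, b, c}" by (auto simp: support_def q_def)
  have abc: "{a, b, c} \<subseteq> S" using B l_props(2) by simp
  have q: "comb q = u *\<^sub>R a + v *\<^sub>R b + w *\<^sub>R c" "weight q = u + v + w"
    using comb_on_support(1,2)[OF sub abc] B by (simp_all add: q_def add.assoc)
  have "card (support l) \<le> 3" using B by simp
  moreover have "support q \<noteq> {}" using cube B by (auto simp: support_def q_def)
  moreover have "0 \<le> q s" "q s < 1" for s using cube by (auto simp: q_def)
  ultimately have 1: "support q = support l" "1 < weight q" "weight q < 2" "comb q \<in> S"
    using box_point[of q] sub p by (simp_all add: q B(1))
  then have "q a \<noteq> 0" "q b \<noteq> 0" "q c \<noteq> 0" unfolding B(1) by (auto simp: support_def)
  then have "u \<noteq> 0" "v \<noteq> 0" "w \<noteq> 0" using B by (auto simp: q_def)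
  then show ?thesis using 1 cube by (auto simp: q)
qed

lemma finite_box_coeffs_of_support:
  assumes B: "support l = {a, b, c}" "a \<noteq> b" "a \<noteq> c" "b \<noteq> c"
  shows "finite (box_coeffs \<Gamma> a b c)"
proof (rule finite_imageD)
  let ?g = "\<lambda>(u, v, w). u *\<^sub>R a + v *\<^sub>R b + w *\<^sub>R c"
  have "?g ` box_coeffs \<Gamma> a b c \<subseteq> S" using box_coeffs_of_support[OF assms] by auto
  then show "finite (?g ` box_coeffs \<Gamma> a b c)" using finite_S by (rule finite_subset)
  have "u = u' \<and> v = v' \<and> w = w'"
    if eq: "u *\<^sub>R a + v *\<^sub>R b + w *\<^sub>R c = u' *\<^sub>R a + v' *\<^sub>R b + w' *\<^sub>R c" for u v w u' v' w'
  proof -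
    define d where "d s = (if s = a then u - u' else if s = b then v - v' else w - w')" for s
    have "(\<Sum>s\<in>{a, b, c}. d s *\<^sub>R s) = (u - u') *\<^sub>R a + ((v - v') *\<^sub>R b + (w - w') *\<^sub>R c)"
      using B by (simp add: d_def)
    also have "\<dots> = 0" using eq by (simp add: algebra_simps)
    finally have "d s = 0" if "s \<in> {a, b, c}" for s
      using indep that unfolding B(1) by (intro independentD[of "{a, b, c}" "{a, b, c}" d]) auto
    then have "d a = 0" "d b = 0" "d c = 0" by auto
    then show ?thesis using B by (simp add: d_def split: if_splits)
  qed
  then show "inj_on ?g (box_coeffs \<Gamma> a b c)" by (auto simp: inj_on_def)
qed

lemma slab_nat_comb3_of_support:
  assumes B: "support l = {a, b, c}" "a \<noteq> b" "a \<noteq> c" "b \<noteq> c"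
    and slab: "\<And>u v w. u *\<^sub>R a + v *\<^sub>R b + w *\<^sub>R c \<in> \<Gamma> \<Longrightarrow> u + v \<in> \<int>"
    and x: "x \<in> \<Gamma>"
  shows "nat_comb3 S x"
proof -
  have abc: "{a, b, c} \<subseteq> S" using B l_props(2) by simp
  have x_eq: "x = l a *\<^sub>R a + l b *\<^sub>R b + l c *\<^sub>R c"
    using comb_on_support(1)[of l "{a, b, c}"] abc B l_props(3) by (simp add: add.assoc)
  have "u + v = 1 \<and> 0 < w \<and> u *\<^sub>R a + v *\<^sub>R b + w *\<^sub>R c \<in> S" if uvw: "(u, v, w) \<in> box_coeffs \<Gamma> a b c" for u v w
  proof -
    have "u *\<^sub>R a + v *\<^sub>R b + w *\<^sub>R c \<in> \<Gamma>" "u < 1" "v < 1"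
      using uvw by (auto simp: box_coeffs_def unit_cube_def)
    moreover note box_coeffs_of_support[OF B uvw]
    ultimately show ?thesis using slab[of u v w] by (auto elim!: Ints_cases)
  qed
  then show ?thesis
    unfolding x_eq using abc S_sub x[unfolded x_eq] l_props(1) finite_box_coeffs_of_support[OF B]
    by (intro slab_nat_comb3) auto
qed

lemma lattice_point_nat_comb3:
  assumes x: "x \<in> \<Gamma>" and card: "card (support l) = 3"
  shows "nat_comb3 S x"
proof -
  obtain a b c where B: "support l = {a, b, c}" "a \<noteq> b" "a \<noteq> c" "b \<noteq> c"
    using card by (auto simp: card_3_iff)
  have abc: "a \<in> \<Gamma>" "b \<in> \<Gamma>" "c \<in> \<Gamma>" using B l_props(2) S_sub by auto
  define K where "K = {(u, v, w). u *\<^sub>R a + v *\<^sub>R b + w *\<^sub>R c \<in> \<Gamma>}"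
  have box: "K \<inter> unit_cube - {0} = box_coeffs \<Gamma> a b c" by (auto simp: K_def box_coeffs_def)
  have "(\<forall>(u, v, w)\<in>K. u + v \<in> \<int>) \<or> (\<forall>(u, v, w)\<in>K. u + w \<in> \<int>) \<or> (\<forall>(u, v, w)\<in>K. v + w \<in> \<int>)"
  proof (rule empty_simplex_pair_integral)
    fix g h assume "g \<in> K" "h \<in> K"
    then show "g - h \<in> K"
      using diff_mem[of "fst g *\<^sub>R a + fst (snd g) *\<^sub>R b + snd (snd g) *\<^sub>R c"
          "fst h *\<^sub>R a + fst (snd h) *\<^sub>R b + snd (snd h) *\<^sub>R c"]
      by (auto simp: K_def algebra_simps)
  next
    fix u v w :: real assume "u \<in> \<int>" "v \<in> \<int>" "w \<in> \<int>"
    then show "(u, v, w) \<in> K" using abc by (auto simp: K_def intro!: add_mem Ints_mem)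
  next
    have "K \<inter> unit_cube \<subseteq> insert 0 (box_coeffs \<Gamma> a b c)" using box by auto
    then show "finite (K \<inter> unit_cube)" using finite_box_coeffs_of_support[OF B] by (auto intro: finite_subset)
  next
    fix u v w assume "(u, v, w) \<in> K \<inter> unit_cube - {0}"
    then show "0 < u \<and> 0 < v \<and> 0 < w \<and> 1 < u + v + w \<and> u + v + w < 2"
      using box_coeffs_of_support[OF B, of u v w] by (simp add: box)
  qed
  then consider (ab) "\<forall>(u, v, w)\<in>K. u + v \<in> \<int>" | (ac) "\<forall>(u, v, w)\<in>K. u + w \<in> \<int>"
    | (bc) "\<forall>(u, v, w)\<in>K. v + w \<in> \<int>" by blast
  then show ?thesis
  proof cases
    case ab
    show ?thesis by (rule slab_nat_comb3_of_support[OF B _ x]) (use ab in \<open>auto simp: K_def\<close>)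
  next
    case ac
    have "support l = {a, c, b}" using B by auto
    moreover have "u + w \<in> \<int>" if "u *\<^sub>R a + w *\<^sub>R c + v *\<^sub>R b \<in> \<Gamma>" for u v w
      using ac that by (auto simp: K_def algebra_simps)
    ultimately show ?thesis using slab_nat_comb3_of_support[of a c b] B x by metis
  next
    case bc
    have "support l = {b, c, a}" using B by auto
    moreover have "v + w \<in> \<int>" if "v *\<^sub>R b + w *\<^sub>R c + u *\<^sub>R a \<in> \<Gamma>" for u v w
      using bc that by (auto simp: K_def algebra_simps)
    ultimately show ?thesis using slab_nat_comb3_of_support[of b c a] B x by metis
  qed
qed

end

text \<open>
  The fractional parts of the coefficients of an optimal representation form a parallelepiped point.
  If it is zero, the coefficients are natural numbers already; otherwise the support has three
  elements and is the base of an empty simplex with apex zero.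
\<close>

theorem integral_caratheodory_dim3:
  assumes dim3: "dim S \<le> 3" and l0: "\<And>s. s \<in> S \<Longrightarrow> 0 \<le> l0 s" and x: "x = (\<Sum>s\<in>S. l0 s *\<^sub>R s)" "x \<in> \<Gamma>"
  shows "\<exists>T\<subseteq>S. card T \<le> dim S \<and> (\<exists>m. x = (\<Sum>t\<in>T. of_nat (m t) *\<^sub>R t))"
proof -
  have "(\<lambda>s. if s \<in> S then l0 s else 0) \<in> nonneg_reps x"
    using l0 x(1) by (auto simp: nonneg_reps_def support_def comb_def)
  then obtain l where l: "l \<in> nonneg_reps x" "independent (support l)"
    and best: "\<forall>l'\<in>nonneg_reps x. no_better l' l"
    using optimal_rep_exists by blast
  note lp = l_props[OF l best] and bp = box_point[OF l best]
  have cl: "card (support l) \<le> dim S"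
    using lp(2) l(2) by (intro independent_card_le_dim) auto
  define b where "b s = frac (l s)" for s
  have b: "0 \<le> b s" "b s < 1" "support b \<subseteq> support l" for s
    by (auto simp: b_def frac_lt_1 support_def)
  have "comb b = x - (\<Sum>s\<in>S. of_int \<lfloor>l s\<rfloor> *\<^sub>R s)"
    using lp(3) by (simp add: comb_def b_def frac_def algebra_simps sum_subtractf)
  moreover have "(\<Sum>s\<in>S. of_int \<lfloor>l s\<rfloor> *\<^sub>R s) \<in> \<Gamma>" using S_sub by (intro sum_mem of_int_mem) auto
  ultimately have cb: "comb b \<in> \<Gamma>" using x(2) diff_mem by simp
  show ?thesis
  proof (cases "support b = {}")
    case True
    then have fl: "l s = of_nat (nat \<lfloor>l s\<rfloor>)" for s
      using lp(1)[of s] by (auto simp: support_def b_def frac_def)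
    have "x = (\<Sum>s\<in>support l. l s *\<^sub>R s)"
      using comb_on_support(1)[of l "support l"] lp(2,3) by simp
    also have "\<dots> = (\<Sum>s\<in>support l. of_nat (nat \<lfloor>l s\<rfloor>) *\<^sub>R s)"
      by (rule sum.cong[OF refl], rule arg_cong[OF fl])
    finally have "x = (\<Sum>s\<in>support l. of_nat (nat \<lfloor>l s\<rfloor>) *\<^sub>R s)" .
    then show ?thesis using lp(2) cl by (intro exI[of _ "support l"] conjI exI[of _ "\<lambda>s. nat \<lfloor>l s\<rfloor>"])
  next
    case False
    then have "card (support l) = 3" using bp(1)[OF b False cb] cl dim3 by simp
    then have n3: "nat_comb3 S x" and d3: "dim S = 3"
      using lattice_point_nat_comb3[OF l best x(2)] cl dim3 by auto
    from nat_comb3_card[OF n3] show ?thesis by (simp only: d3)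
  qed
qed

end

section \<open>The Hilbert basis of a simplicial cone\<close>

text \<open>Otherwise the simplifier turns the index set \<open>{1..k}\<close> into \<open>{Suc 0..k}\<close>.\<close>

declare One_nat_def [simp del]

lemma finite_integer_points_ball: "finite {x :: real ^ 'n. x \<in> integer_points \<and> norm x \<le> b}"
proof (rule finite_subset)
  let ?A = "{t :: real. t \<in> \<int> \<and> - b \<le> t \<and> t \<le> b}"
  show "{x :: real ^ 'n. x \<in> integer_points \<and> norm x \<le> b} \<subseteq> (\<lambda>g. \<chi> i. g i) ` (UNIV \<rightarrow>\<^sub>E ?A)"
  proof
    fix x :: "real ^ 'n" assume x: "x \<in> {x. x \<in> integer_points \<and> norm x \<le> b}"
    have "\<bar>x $ i\<bar> \<le> b" for i using component_le_norm_cart[of x i] x by simp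
    then have "(\<lambda>i. x $ i) \<in> UNIV \<rightarrow>\<^sub>E ?A" using x by (auto simp: integer_points_def abs_le_iff minus_le_iff)
    moreover have "x = (\<chi> i. x $ i)" by (simp add: vec_eq_iff)
    ultimately show "x \<in> (\<lambda>g. \<chi> i. g i) ` (UNIV \<rightarrow>\<^sub>E ?A)" by blast
  qed
  show "finite ((\<lambda>g. (\<chi> i. g i) :: real ^ 'n) ` (UNIV \<rightarrow>\<^sub>E ?A))"
    by (intro finite_imageI finite_PiE) (auto intro: finite_int_segment)
qed

lemma integer_points_add: "x \<in> integer_points \<Longrightarrow> y \<in> integer_points \<Longrightarrow> x + y \<in> integer_points"
  and integer_points_diff: "x \<in> integer_points \<Longrightarrow> y \<in> integer_points \<Longrightarrow> x - y \<in> integer_points"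
  and integer_points_scale: "t \<in> \<int> \<Longrightarrow> x \<in> integer_points \<Longrightarrow> t *\<^sub>R x \<in> integer_points"
  and integer_points_0: "0 \<in> integer_points"
  by (auto simp: integer_points_def)

locale simplicial_cone =
  fixes r :: "nat \<Rightarrow> real ^ 'n" and k :: nat
  assumes integral: "i \<in> {1..k} \<Longrightarrow> r i \<in> integer_points" and indep: "lin_indep_family k r"
begin

definition lattice :: "(real ^ 'n) set" where
  "lattice = span (r ` {1..k}) \<inter> integer_points"

definition points :: "(real ^ 'n) set" where
  "points = pos_hull k r \<inter> integer_points"

definition coord :: "nat \<Rightarrow> real ^ 'n \<Rightarrow> real" where
  "coord i x = x \<bullet> dual_basis k r i"

lemma coord_simps [simp]:
  "coord i (x + y) = coord i x + coord i y" "coord i (x - y) = coord i x - coord i y"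
  "coord i (t *\<^sub>R x) = t * coord i x" "coord i (sum g A) = (\<Sum>a\<in>A. coord i (g a))" "coord i 0 = 0"
  by (simp_all add: coord_def inner_add_left inner_diff_left inner_sum_left)

lemma coord_r: "i \<in> {1..k} \<Longrightarrow> j \<in> {1..k} \<Longrightarrow> coord j (r i) = (if i = j then 1 else 0)"
  using theI'[OF dual_basis_unique[OF indep, of j]] unfolding dual_basis_def coord_def by auto

lemma coord_sum_r: "j \<in> {1..k} \<Longrightarrow> A \<subseteq> {1..k} \<Longrightarrow> coord j (\<Sum>i\<in>A. c i *\<^sub>R r i) = (if j \<in> A then c j else 0)"
proof -
  assume "j \<in> {1..k}" "A \<subseteq> {1..k}"
  then have "coord j (\<Sum>i\<in>A. c i *\<^sub>R r i) = (\<Sum>i\<in>A. if j = i then c i else 0)"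
    unfolding coord_simps by (intro sum.cong) (auto simp: coord_r)
  also have "\<dots> = (if j \<in> A then c j else 0)"
    using \<open>A \<subseteq> {1..k}\<close> by (intro sum.delta') (auto intro: finite_subset)
  finally show ?thesis .
qed

lemma span_r: "i \<in> {1..k} \<Longrightarrow> r i \<in> span (r ` {1..k})"
  by (auto intro: span_base)

lemma coord_expansion: "x \<in> span (r ` {1..k}) \<Longrightarrow> x = (\<Sum>i=1..k. coord i x *\<^sub>R r i)"
proof -
  assume "x \<in> span (r ` {1..k})"
  then obtain u where "x = (\<Sum>v\<in>r ` {1..k}. u v *\<^sub>R v)" by (auto simp: span_finite)
  also have "\<dots> = (\<Sum>i=1..k. u (r i) *\<^sub>R r i)"
    using indep by (subst sum.reindex) (auto simp: lin_indep_family_def)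
  finally have x: "x = (\<Sum>i=1..k. u (r i) *\<^sub>R r i)" .
  then have "coord i x = u (r i)" if "i \<in> {1..k}" for i using that coord_sum_r[of i "{1..k}"] by auto
  then show ?thesis by (subst x) (auto intro!: sum.cong)
qed

lemma coord_ext:
  assumes "x \<in> span (r ` {1..k})" "y \<in> span (r ` {1..k})" "\<And>i. i \<in> {1..k} \<Longrightarrow> coord i x = coord i y"
  shows "x = y"
  proof -
  have "(\<Sum>i=1..k. coord i x *\<^sub>R r i) = (\<Sum>i=1..k. coord i y *\<^sub>R r i)"
    using assms(3) by (intro sum.cong) auto
  then show ?thesis using coord_expansion[OF assms(1)] coord_expansion[OF assms(2)] by simp
qed

lemma pos_hull_iff: "x \<in> pos_hull k r \<longleftrightarrow> x \<in> span (r ` {1..k}) \<and> (\<forall>i\<in>{1..k}. 0 \<le> coord i x)"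
proof
  assume "x \<in> pos_hull k r"
  then obtain c where "x = (\<Sum>i=1..k. c i *\<^sub>R r i)" "\<forall>i\<in>{1..k}. 0 \<le> c i" by (auto simp: pos_hull_def)
  then show "x \<in> span (r ` {1..k}) \<and> (\<forall>i\<in>{1..k}. 0 \<le> coord i x)"
    by (auto simp del: coord_simps simp: coord_sum_r intro!: span_sum span_scale span_r)
next
  assume "x \<in> span (r ` {1..k}) \<and> (\<forall>i\<in>{1..k}. 0 \<le> coord i x)"
  then show "x \<in> pos_hull k r" unfolding pos_hull_def
    using coord_expansion[of x] by (intro CollectI exI[of _ "\<lambda>i. coord i x"]) auto
qed

lemma points_iff: "x \<in> points \<longleftrightarrow> x \<in> lattice \<and> (\<forall>i\<in>{1..k}. 0 \<le> coord i x)"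
  by (auto simp: points_def lattice_def pos_hull_iff)

lemma lattice_add: "x \<in> lattice \<Longrightarrow> y \<in> lattice \<Longrightarrow> x + y \<in> lattice"
  and lattice_diff: "x \<in> lattice \<Longrightarrow> y \<in> lattice \<Longrightarrow> x - y \<in> lattice"
  and lattice_scale: "t \<in> \<int> \<Longrightarrow> x \<in> lattice \<Longrightarrow> t *\<^sub>R x \<in> lattice"
  and lattice_0: "0 \<in> lattice"
  and lattice_r: "i \<in> {1..k} \<Longrightarrow> r i \<in> lattice"
  by (auto simp: lattice_def integral integer_points_add integer_points_diff integer_points_scale
    integer_points_0 span_add span_diff span_scale span_zero span_r)

lemma lattice_sum: "(\<And>i. i \<in> I \<Longrightarrow> g i \<in> lattice) \<Longrightarrow> sum g I \<in> lattice"
  by (induction I rule: infinite_finite_induct) (auto simp: lattice_0 lattice_add)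

lemma lattice_span: "x \<in> lattice \<Longrightarrow> x \<in> span (r ` {1..k})"
  by (simp add: lattice_def)

lemma points_add: "x \<in> points \<Longrightarrow> y \<in> points \<Longrightarrow> x + y \<in> points"
  by (auto simp: points_iff lattice_add)

lemma points_scale: "x \<in> points \<Longrightarrow> of_nat n *\<^sub>R x \<in> points"
  by (auto simp: points_iff lattice_scale)

lemma points_0: "0 \<in> points"
  by (auto simp: points_iff lattice_0)

lemma points_r: "i \<in> {1..k} \<Longrightarrow> r i \<in> points"
  by (auto simp: points_iff lattice_r coord_r)

lemma points_sum: "(\<And>i. i \<in> I \<Longrightarrow> g i \<in> points) \<Longrightarrow> sum g I \<in> points"
  by (induction I rule: infinite_finite_induct) (auto simp: points_0 points_add)

lemma points_pointed: "x \<in> points \<Longrightarrow> - x \<in> points \<Longrightarrow> x = 0"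
proof (rule coord_ext)
  fix i assume x: "x \<in> points" "- x \<in> points" and i: "i \<in> {1..k}"
  then have "0 \<le> coord i x" "0 \<le> coord i (- x)" by (auto simp: points_iff)
  moreover have "coord i (- x) = - coord i x" by (simp add: coord_def)
  ultimately have "coord i x = 0" by simp
  then show "coord i x = coord i 0" by simp
qed (auto simp: points_iff lattice_span span_zero)

lemma finite_interval: "finite {u \<in> points. x - u \<in> points}"
proof (rule finite_subset[OF _ finite_integer_points_ball])
  show "{u \<in> points. x - u \<in> points} \<subseteq>
    {u. u \<in> integer_points \<and> norm u \<le> (\<Sum>i=1..k. coord i x * norm (r i))}"
  proof safe
    fix u assume u: "u \<in> points" "x - u \<in> points"
    then show "u \<in> integer_points" by (simp add: points_def)
    have c: "0 \<le> coord i u \<and> coord i u \<le> coord i x" if "i \<in> {1..k}" for i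
      using u that by (force simp: points_iff)
    have "norm u = norm (\<Sum>i=1..k. coord i u *\<^sub>R r i)"
      using coord_expansion u by (metis points_iff lattice_span)
    also have "\<dots> \<le> (\<Sum>i=1..k. norm (coord i u *\<^sub>R r i))" by (rule norm_sum)
    also have "\<dots> \<le> (\<Sum>i=1..k. coord i x * norm (r i))"
      using c by (intro sum_mono) (auto intro!: mult_right_mono)
    finally show "norm u \<le> (\<Sum>i=1..k. coord i x * norm (r i))" .
  qed
qed

definition irreducibles :: "(real ^ 'n) set" where
  "irreducibles = {h \<in> points. h \<noteq> 0 \<and> (\<forall>u\<in>points. \<forall>v\<in>points. h = u + v \<longrightarrow> u = 0 \<or> v = 0)}"

lemma irreducibles_points: "h \<in> irreducibles \<Longrightarrow> h \<in> points"
  by (simp add: irreducibles_def)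

lemma irreducible_coord_le_1:
  assumes h: "h \<in> irreducibles" and i: "i \<in> {1..k}"
  shows "coord i h \<le> 1"
proof (rule ccontr)
  assume 1: "\<not> coord i h \<le> 1"
  have "h - r i \<in> points"
    using h 1 i by (auto simp: points_iff irreducibles_def lattice_diff lattice_r coord_r)
  moreover have "h = r i + (h - r i)" "r i \<in> points" using points_r i by auto
  ultimately have "r i = 0 \<or> h - r i = 0" using h unfolding irreducibles_def by blast
  then have "coord i h = coord i (r i) \<or> coord i (r i) = coord i 0" by auto
  then show False using 1 i by (auto simp: coord_r)
qed

lemma finite_irreducibles: "finite irreducibles"
proof (rule finite_subset[OF _ finite_interval])
  have "coord j (sum r {1..k}) = 1" if "j \<in> {1..k}" for j
    using coord_sum_r[of j "{1..k}" "\<lambda>_. 1"] that by simp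
  then show "irreducibles \<subseteq> {u \<in> points. sum r {1..k} - u \<in> points}"
    using irreducible_coord_le_1 irreducibles_points
    by (auto simp: points_iff simp del: coord_simps(4) intro!: lattice_diff lattice_sum lattice_r)
qed

text \<open>
  Induction on the number of points below \<open>x\<close>, which is finite and drops for both summands of a
  proper decomposition.
\<close>

lemma irreducible_decomposition:
  assumes "x \<in> points"
  shows "\<exists>m :: real ^ 'n \<Rightarrow> nat. x = (\<Sum>h\<in>irreducibles. of_nat (m h) *\<^sub>R h)"
  using assms
proof (induction "card {u \<in> points. x - u \<in> points}" arbitrary: x rule: less_induct)
  case less
  consider "x = 0" | "x \<in> irreducibles" | "x \<noteq> 0" "x \<notin> irreducibles" by blast
  then show ?case
  proof cases
    case 1 then show ?thesis by (auto intro!: exI[of _ "\<lambda>_. 0"])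
  next
    case 2
    have "(\<Sum>h\<in>irreducibles. of_nat (if h = x then 1 else 0) *\<^sub>R h) = (\<Sum>h\<in>irreducibles. if h = x then h else 0)"
      by (intro sum.cong) auto
    also have "\<dots> = x" using 2 finite_irreducibles by simp
    finally show ?thesis by (intro exI[of _ "\<lambda>h. if h = x then 1 else 0"]) (rule sym)
  next
    case 3
    then obtain u v where uv: "u \<in> points" "v \<in> points" "x = u + v" "u \<noteq> 0" "v \<noteq> 0"
      using less.prems unfolding irreducibles_def by blast
    define D where "D a = {w \<in> points. a - w \<in> points}" for a
    have smaller: "card {w \<in> points. a - w \<in> points} < card {w \<in> points. x - w \<in> points}"
      if ab: "a \<in> points" "b \<in> points" "x = a + b" "b \<noteq> 0" for a b
    proof -
      have "D a \<subseteq> D x"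
      proof (rule subsetI)
        fix w assume "w \<in> D a"
        then have "w \<in> points" "(a - w) + b \<in> points" using points_add ab(2) unfolding D_def by blast+
        then show "w \<in> D x" by (simp add: D_def ab(3) algebra_simps)
      qed
      moreover have "x \<in> D x" using less.prems points_0 by (simp add: D_def)
      moreover have "x \<notin> D a" using points_pointed[OF ab(2)] ab(3,4) by (auto simp: D_def)
      ultimately have "D a \<subset> D x" by blast
      moreover have "finite (D x)" unfolding D_def by (rule finite_interval)
      ultimately show ?thesis unfolding D_def[symmetric] by (intro psubset_card_mono)
    qed
    obtain m :: "_ \<Rightarrow> nat" where m: "u = (\<Sum>h\<in>irreducibles. of_nat (m h) *\<^sub>R h)"
      using less.hyps[OF smaller[OF uv(1,2,3,5)] uv(1)] by (elim exE) (rule that)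
    have vu: "x = v + u" using uv(3) by (simp add: add.commute)
    obtain m' :: "_ \<Rightarrow> nat" where m': "v = (\<Sum>h\<in>irreducibles. of_nat (m' h) *\<^sub>R h)"
      using less.hyps[OF smaller[OF uv(2,1) vu uv(4)] uv(2)] by (elim exE) (rule that)
    have "x = (\<Sum>h\<in>irreducibles. of_nat (m h + m' h) *\<^sub>R h)"
      unfolding uv(3) of_nat_add scaleR_add_left sum.distrib m[symmetric] m'[symmetric] ..
    then show ?thesis by (intro exI[of _ "\<lambda>h. m h + m' h"])
  qed
qed

lemma summand_below:
  assumes "finite F" "F \<subseteq> points" "h \<in> F" "m h \<noteq> 0"
  shows "(\<Sum>h\<in>F. of_nat (m h) *\<^sub>R h) - h \<in> points"
proof -
  obtain n where n: "m h = Suc n" using assms(4) by (cases "m h") auto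
  have "(\<Sum>h\<in>F. of_nat (m h) *\<^sub>R h) - h = of_nat n *\<^sub>R h + (\<Sum>h\<in>F - {h}. of_nat (m h) *\<^sub>R h)"
    using assms by (simp add: sum.remove[of F h] n algebra_simps)
  moreover have "\<dots> \<in> points" using assms by (intro points_add points_sum points_scale) auto
  ultimately show ?thesis by simp
qed

lemma irreducible_in_generators:
  assumes H: "hilbert_generating (pos_hull k r) H" and h: "h \<in> irreducibles"
  shows "h \<in> H"
proof -
  have Hp: "H \<subseteq> points" using H by (simp add: hilbert_generating_def points_def)
  have "h \<in> nat_combinations H" using H h by (auto simp: hilbert_generating_def irreducibles_def points_def)
  then obtain F and c :: "_ \<Rightarrow> nat" where F: "finite F" "F \<subseteq> H" and hc: "h = (\<Sum>g\<in>F. of_nat (c g) *\<^sub>R g)"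
    by (auto simp: nat_combinations_def)
  have "\<exists>g\<in>F. of_nat (c g) *\<^sub>R g \<noteq> 0"
  proof (rule ccontr)
    assume "\<not> ?thesis"
    then have "h = 0" unfolding hc by (intro sum.neutral) auto
    then show False using h by (simp add: irreducibles_def)
  qed
  then obtain g where g: "g \<in> F" "c g \<noteq> 0" "g \<noteq> 0" by auto
  have "h - g \<in> points" unfolding hc using F Hp g by (intro summand_below) auto
  moreover have "h = g + (h - g)" "g \<in> points" using g F Hp by auto
  ultimately have "h - g = 0" using h g unfolding irreducibles_def by blast
  then show ?thesis using g F by auto
qed

text \<open>
  The irreducible points generate, and they belong to every generating set, so they form the unique
  minimal generating set.
\<close>

lemma hilbert_basis_eq: "hilbert_basis (pos_hull k r) = irreducibles"
proof -
  have gen: "hilbert_generating (pos_hull k r) irreducibles"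
    unfolding hilbert_generating_def points_def[symmetric] nat_combinations_def
    using irreducibles_points irreducible_decomposition finite_irreducibles by fastforce
  show ?thesis unfolding hilbert_basis_def
  proof (rule the_equality)
    show "hilbert_generating (pos_hull k r) irreducibles \<and>
      (\<forall>H'\<subseteq>irreducibles. hilbert_generating (pos_hull k r) H' \<longrightarrow> H' = irreducibles)"
      using gen irreducible_in_generators by blast
    fix H assume "hilbert_generating (pos_hull k r) H \<and>
      (\<forall>H'\<subseteq>H. hilbert_generating (pos_hull k r) H' \<longrightarrow> H' = H)"
    then show "H = irreducibles" using gen irreducible_in_generators by blast
  qed
qed

definition short_rep :: "real ^ 'n \<Rightarrow> nat \<Rightarrow> bool" where
  "short_rep z p \<longleftrightarrow> (\<exists>F c. F \<subseteq> irreducibles \<and> card F \<le> p \<and> z = (\<Sum>h\<in>F. of_nat (c h :: nat) *\<^sub>R h))"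

lemma short_rep_hilbert_length:
  assumes "short_rep z p" shows "hilbert_length (pos_hull k r) z \<le> p"
proof -
  obtain F c where F: "F \<subseteq> irreducibles" "card F \<le> p" "z = (\<Sum>h\<in>F. of_nat (c h :: nat) *\<^sub>R h)"
    using assms unfolding short_rep_def by (elim exE conjE) (erule (2) that)
  have "finite F" using F finite_irreducibles by (auto intro: finite_subset)
  then obtain b where b: "bij_betw b {1..card F} F" using ex_bij_betw_nat_finite_1 by blast
  have "z = (\<Sum>i=1..card F. of_nat (c (b i)) *\<^sub>R b i)"
    unfolding F(3) using b by (rule sum.reindex_bij_betw[symmetric])
  moreover have "\<forall>i\<in>{1..card F}. b i \<in> hilbert_basis (pos_hull k r)"
    using b F unfolding hilbert_basis_eq by (auto dest: bij_betwE)
  ultimately have "hilbert_length (pos_hull k r) z \<le> card F"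
    unfolding hilbert_length_def by (intro Least_le exI[of _ "\<lambda>i. c (b i)"] exI[of _ b]) auto
  then show ?thesis using F by simp
qed

lemma hilbert_length_span:
  assumes "z \<in> points"
  shows "\<exists>T\<subseteq>irreducibles. card T \<le> hilbert_length (pos_hull k r) z \<and> z \<in> span T"
proof -
  let ?Q = "\<lambda>m. \<exists>(l :: nat \<Rightarrow> nat) h.
    (\<forall>i\<in>{1..m}. h i \<in> hilbert_basis (pos_hull k r)) \<and> z = (\<Sum>i=1..m. of_nat (l i) *\<^sub>R h i)"
  obtain c where c: "z = (\<Sum>h\<in>irreducibles. of_nat (c h :: nat) *\<^sub>R h)"
    using irreducible_decomposition[OF assms] by (elim exE) (erule that)
  obtain b where b: "bij_betw b {1..card irreducibles} irreducibles"
    using ex_bij_betw_nat_finite_1[OF finite_irreducibles] by blast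
  have "z = (\<Sum>i=1..card irreducibles. of_nat (c (b i)) *\<^sub>R b i)"
    unfolding c using b by (rule sum.reindex_bij_betw[symmetric])
  moreover have "\<forall>i\<in>{1..card irreducibles}. b i \<in> hilbert_basis (pos_hull k r)"
    using b unfolding hilbert_basis_eq by (auto dest: bij_betwE)
  ultimately have "?Q (card irreducibles)"
    by (intro exI[of _ "\<lambda>i. c (b i)"] exI[of _ b] conjI)
  then have "?Q (hilbert_length (pos_hull k r) z)" unfolding hilbert_length_def by (rule LeastI)
  then obtain l :: "nat \<Rightarrow> nat" and h where h: "\<forall>i\<in>{1..hilbert_length (pos_hull k r) z}. h i \<in> irreducibles"
    "z = (\<Sum>i=1..hilbert_length (pos_hull k r) z. of_nat (l i) *\<^sub>R h i)"
    unfolding hilbert_basis_eq by blast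
  show ?thesis
  proof (intro exI[of _ "h ` {1..hilbert_length (pos_hull k r) z}"] conjI)
    show "card (h ` {1..hilbert_length (pos_hull k r) z}) \<le> hilbert_length (pos_hull k r) z"
      using card_image_le[of "{1..hilbert_length (pos_hull k r) z}" h] by simp
    show "z \<in> span (h ` {1..hilbert_length (pos_hull k r) z})"
      by (subst h(2)) (intro span_sum span_scale span_base imageI)
  qed (use h in auto)
qed

lemma dim_span_r: "dim (span (r ` {1..k})) = k"
  using indep unfolding dim_span lin_indep_family_def by (simp add: dim_eq_card_independent card_image)

text \<open>
  A vector \<open>w\<close> of the span that is orthogonal to \<open>T\<close> turns membership into a polynomial equation in
  \<open>t\<close> with coefficients \<open>r i \<bullet> w\<close>, which are not all zero.
\<close>

lemma moment_curve_avoids: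
  assumes T: "T \<subseteq> span (r ` {1..k})" "finite T" "card T < k"
  shows "finite {t :: nat. (\<Sum>i=1..k. (of_nat t ^ i) *\<^sub>R r i) \<in> span T}"
proof -
  have "dim T < k" using T dim_le_card'[of T] by simp
  then have "span T \<noteq> span (r ` {1..k})" using dim_span_r by (metis dim_span less_irrefl)
  moreover have "span T \<subseteq> span (r ` {1..k})" using T by (simp add: span_minimal)
  ultimately obtain w where w: "w \<noteq> 0" "w \<in> span (r ` {1..k})" "\<And>y. y \<in> span T \<Longrightarrow> orthogonal w y"
    using orthogonal_to_subspace_exists_gen[of T "r ` {1..k}"] by (metis psubsetI)
  define c where "c i = (if 1 \<le> i then r i \<bullet> w else 0)" for i
  have "\<exists>i\<le>k. c i \<noteq> 0"
  proof (rule ccontr)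
    assume no: "\<not> ?thesis"
    have "orthogonal w y" if "y \<in> r ` {1..k}" for y
      using that no by (force simp: orthogonal_def c_def inner_commute)
    then have "orthogonal w w" using w(2) orthogonal_to_span by blast
    then show False using w(1) by (simp add: orthogonal_def)
  qed
  then have fin: "finite {t. (\<Sum>i\<le>k. c i * t ^ i) = 0}" using polyfun_finite_roots by blast
  have val: "(\<Sum>i\<le>k. c i * t ^ i) = (\<Sum>i=1..k. (t ^ i) *\<^sub>R r i) \<bullet> w" for t :: real
  proof -
    have "(\<Sum>i\<le>k. c i * t ^ i) = (\<Sum>i=1..k. c i * t ^ i)"
      by (rule sum.mono_neutral_right) (auto simp: c_def)
    also have "\<dots> = (\<Sum>i=1..k. (t ^ i) *\<^sub>R r i) \<bullet> w"
      unfolding inner_sum_left by (intro sum.cong) (auto simp: c_def)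
    finally show ?thesis .
  qed
  have "real ` {t :: nat. (\<Sum>i=1..k. (of_nat t ^ i) *\<^sub>R r i) \<in> span T} \<subseteq> {t. (\<Sum>i\<le>k. c i * t ^ i) = 0}"
    unfolding val using w(3) by (auto simp: orthogonal_def inner_commute[of _ w])
  then show ?thesis using fin by (meson finite_imageD finite_subset inj_on_of_nat)
qed

lemma long_point_exists: "\<exists>z\<in>points. k \<le> hilbert_length (pos_hull k r) z"
proof -
  let ?z = "\<lambda>t :: nat. \<Sum>i=1..k. (of_nat t ^ i :: real) *\<^sub>R r i"
  let ?A = "{T. T \<subseteq> irreducibles \<and> card T < k}"
  have "finite (\<Union>T\<in>?A. {t. ?z t \<in> span T})"
  proof (intro finite_UN_I moment_curve_avoids)
    show "finite ?A" using finite_irreducibles by simp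
    fix T assume T: "T \<in> ?A"
    then show "T \<subseteq> span (r ` {1..k})" using irreducibles_points lattice_span by (auto simp: points_iff)
    show "finite T" using T finite_irreducibles by (auto intro: finite_subset)
  qed auto
  then obtain t where t: "t \<notin> (\<Union>T\<in>?A. {t. ?z t \<in> span T})" 
    using ex_new_if_finite[OF infinite_UNIV_nat] by blast
  have z: "?z t \<in> points"
    by (intro points_sum) (simp add: points_scale points_r flip: of_nat_power)
  obtain T where T: "T \<subseteq> irreducibles" "card T \<le> hilbert_length (pos_hull k r) (?z t)" "?z t \<in> span T"
    using hilbert_length_span[OF z] by blast
  then have "\<not> card T < k" using t by blast
  then show ?thesis using T(2) z by (intro bexI[of _ "?z t"]) auto
qed

lemma ICR_eqI:
  assumes "\<And>z. z \<in> points \<Longrightarrow> short_rep z k"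
  shows "ICR (pos_hull k r) = k"
proof -
  have le: "hilbert_length (pos_hull k r) z \<le> k" if "z \<in> points" for z
    using short_rep_hilbert_length assms that by blast
  obtain z where z: "z \<in> points" "k \<le> hilbert_length (pos_hull k r) z" using long_point_exists by blast
  then have "hilbert_length (pos_hull k r) z = k" using le by (simp add: antisym)
  then have "k \<in> hilbert_length (pos_hull k r) ` points" using z by (metis imageI)
  moreover have "hilbert_length (pos_hull k r) ` points \<subseteq> {..k}" using le by auto
  moreover from this have "finite (hilbert_length (pos_hull k r) ` points)" by (rule finite_subset) simp
  ultimately show ?thesis unfolding ICR_def points_def[symmetric] by (intro Max_eqI) auto
qed

lemma dim_pos_hull: "dim (pos_hull k r) = k"
proof (rule antisym)
  have "pos_hull k r \<subseteq> span (r ` {1..k})" by (auto simp: pos_hull_iff)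
  from dim_subset[OF this] show "dim (pos_hull k r) \<le> k" by (simp only: dim_span_r)
  have "r ` {1..k} \<subseteq> pos_hull k r" using points_r by (auto simp: points_def)
  then show "k \<le> dim (pos_hull k r)" using dim_subset[of "r ` {1..k}"] dim_span_r by simp
qed

lemma short_rep_add:
  assumes "short_rep x p" "short_rep y q" shows "short_rep (x + y) (p + q)"
proof -
  obtain F c where F: "F \<subseteq> irreducibles" "card F \<le> p" "x = (\<Sum>h\<in>F. of_nat (c h :: nat) *\<^sub>R h)"
    using assms(1) unfolding short_rep_def by (elim exE conjE) (erule (2) that)
  obtain G d where G: "G \<subseteq> irreducibles" "card G \<le> q" "y = (\<Sum>h\<in>G. of_nat (d h :: nat) *\<^sub>R h)"
    using assms(2) unfolding short_rep_def by (elim exE conjE) (erule (2) that)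
  have fin: "finite F" "finite G" using F G finite_irreducibles by (auto intro: finite_subset)
  define e where "e h = (if h \<in> F then c h else 0) + (if h \<in> G then d h else 0)" for h
  have "x = (\<Sum>h\<in>F \<union> G. of_nat (if h \<in> F then c h else 0) *\<^sub>R h)"
    unfolding F(3) using fin by (intro sum.mono_neutral_cong_left) auto
  moreover have "y = (\<Sum>h\<in>F \<union> G. of_nat (if h \<in> G then d h else 0) *\<^sub>R h)"
    unfolding G(3) using fin by (intro sum.mono_neutral_cong_left) auto
  ultimately have "x + y = (\<Sum>h\<in>F \<union> G. of_nat (e h) *\<^sub>R h)"
    by (simp only: e_def of_nat_add scaleR_add_left sum.distrib)
  moreover have "card (F \<union> G) \<le> p + q" using card_Un_le[of F G] F G by simp
  ultimately show ?thesis unfolding short_rep_def using F G by (intro exI[of _ "F \<union> G"] exI[of _ e]) auto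
qed

lemma short_rep_mono: "short_rep z p \<Longrightarrow> p \<le> q \<Longrightarrow> short_rep z q"
  unfolding short_rep_def by (elim exE conjE, intro exI conjI) (assumption, erule order_trans, assumption+)

lemma short_rep_r:
  assumes J: "J \<subseteq> {1..k}" "\<And>i. i \<in> J \<Longrightarrow> r i \<in> irreducibles"
  shows "short_rep (\<Sum>i\<in>J. of_nat (n i :: nat) *\<^sub>R r i) (card J)"
proof -
  have inj: "inj_on r J" using indep J unfolding lin_indep_family_def by (blast intro: inj_on_subset)
  have fin: "finite J" using J by (auto intro: finite_subset)
  have "(\<Sum>i\<in>J. of_nat (n i) *\<^sub>R r i) = (\<Sum>h\<in>r ` J. of_nat (n (the_inv_into J r h)) *\<^sub>R h)"
    using inj by (subst sum.reindex) (auto simp: the_inv_into_f_f)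
  moreover have "card (r ` J) \<le> card J" using fin by (rule card_image_le)
  ultimately show ?thesis unfolding short_rep_def
    using J by (intro exI[of _ "r ` J"] exI[of _ "\<lambda>h. n (the_inv_into J r h)"] conjI) auto
qed

end

section \<open>Reduction to the diagonal sublattice\<close>

context simplicial_cone begin

text \<open>
  A proper summand of \<open>r i\<close> is a fraction of \<open>r i\<close>, which the hypothesis excludes.
\<close>

lemma irreducible_r:
  assumes i: "i \<in> {1..k}"
    and int: "\<And>x. x \<in> points \<Longrightarrow> (\<And>j. j \<in> {1..k} \<Longrightarrow> j \<noteq> i \<Longrightarrow> coord j x = 0) \<Longrightarrow> coord i x \<in> \<int>"
  shows "r i \<in> irreducibles"
proof -
  have "r i \<noteq> 0" using coord_r[OF i i] by auto
  moreover have "u = 0 \<or> v = 0" if uv: "u \<in> points" "v \<in> points" "r i = u + v" for u v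
  proof -
    have sum: "coord j u + coord j v = (if i = j then 1 else 0)" if "j \<in> {1..k}" for j
      using coord_r[OF i that] unfolding uv(3) by simp
    have nn: "0 \<le> coord j u" "0 \<le> coord j v" if "j \<in> {1..k}" for j using uv that by (auto simp: points_iff)
    have z: "coord j u = 0" "coord j v = 0" if "j \<in> {1..k}" "j \<noteq> i" for j
      using sum[OF that(1)] nn[OF that(1)] that(2) by auto
    have "coord i u \<in> \<int>" using int uv z by blast
    then have "coord i u = 0 \<or> coord i v = 0"
      using sum[OF i] nn[OF i] by (auto elim!: Ints_cases)
    then have "(\<forall>j\<in>{1..k}. coord j u = 0) \<or> (\<forall>j\<in>{1..k}. coord j v = 0)" using z by metis
    then show ?thesis
      using coord_ext[of u 0] coord_ext[of v 0] uv by (auto simp: points_iff lattice_span span_zero)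
  qed
  ultimately show ?thesis using points_r[OF i] by (auto simp: irreducibles_def)
qed

lemma decomposition_below:
  assumes x: "x \<in> points" and sub: "\<And>h. h \<in> irreducibles \<Longrightarrow> x - h \<in> points \<Longrightarrow> h \<in> S"
    and S: "finite S"
  shows "\<exists>m :: _ \<Rightarrow> nat. x = (\<Sum>h\<in>S. of_nat (m h) *\<^sub>R h)"
proof -
  obtain m :: "_ \<Rightarrow> nat" where m: "x = (\<Sum>h\<in>irreducibles. of_nat (m h) *\<^sub>R h)"
    using irreducible_decomposition[OF x] by (elim exE) (rule that)
  define m' where "m' h = (if h \<in> irreducibles then m h else 0)" for h
  have "h \<in> S" if "h \<in> irreducibles" "m h \<noteq> 0" for h
    using that sub summand_below[of irreducibles h m] finite_irreducibles irreducibles_points m by blast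
  then have out: "m' h = 0" if "h \<notin> S" for h using that by (auto simp: m'_def)
  have "x = (\<Sum>h\<in>irreducibles. of_nat (m' h) *\<^sub>R h)" unfolding m by (intro sum.cong) (auto simp: m'_def)
  also have "\<dots> = (\<Sum>h\<in>irreducibles \<union> S. of_nat (m' h) *\<^sub>R h)"
    using S finite_irreducibles by (intro sum.mono_neutral_left) (auto simp: m'_def)
  also have "\<dots> = (\<Sum>h\<in>S. of_nat (m' h) *\<^sub>R h)"
    using S finite_irreducibles out by (intro sum.mono_neutral_right) auto
  finally show ?thesis by (intro exI[of _ m'])
qed

end

text \<open>
  The meaning of the cosets for the coordinates of lattice points: \<open>cls i\<close> stands for the coset of the
  \<open>i\<close>-th dual basis vector and \<open>Q\<close> for the set of nontrivial cosets.
\<close>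

locale coset_classes = simplicial_cone r k for r :: "nat \<Rightarrow> real ^ 'n" and k +
  fixes cls :: "nat \<Rightarrow> 'c" and Q :: "'c set"
  assumes Q_sub: "Q \<subseteq> cls ` {1..k}" and Q_card: "card Q \<le> 3"
    and same_class: "i \<in> {1..k} \<Longrightarrow> j \<in> {1..k} \<Longrightarrow> cls i = cls j \<Longrightarrow> x \<in> lattice \<Longrightarrow> coord i x - coord j x \<in> \<int>"
    and trivial_class: "i \<in> {1..k} \<Longrightarrow> cls i \<notin> Q \<Longrightarrow> x \<in> lattice \<Longrightarrow> coord i x \<in> \<int>"
begin

lemma finite_Q: "finite Q"
  using Q_sub by (rule finite_subset) simp

definition members :: "'c \<Rightarrow> nat set" where
  "members q = {i \<in> {1..k}. cls i = q}"

definition class_sum :: "'c \<Rightarrow> real ^ 'n" where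
  "class_sum q = (\<Sum>i\<in>members q. r i)"

definition diagonal :: "(real ^ 'n) set" where
  "diagonal = {x \<in> lattice. (\<forall>i\<in>{1..k}. cls i \<notin> Q \<longrightarrow> coord i x = 0) \<and>
     (\<forall>i\<in>{1..k}. \<forall>j\<in>{1..k}. cls i = cls j \<longrightarrow> coord i x = coord j x)}"

lemma diagonalI:
  assumes "x \<in> lattice" "\<And>i. i \<in> {1..k} \<Longrightarrow> cls i \<notin> Q \<Longrightarrow> coord i x = 0"
    and "\<And>i j. i \<in> {1..k} \<Longrightarrow> j \<in> {1..k} \<Longrightarrow> cls i = cls j \<Longrightarrow> coord i x = coord j x"
  shows "x \<in> diagonal"
  using assms unfolding diagonal_def by blast

lemma diagonalD:
  assumes "x \<in> diagonal"
  shows "x \<in> lattice" "i \<in> {1..k} \<Longrightarrow> cls i \<notin> Q \<Longrightarrow> coord i x = 0"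
    and "i \<in> {1..k} \<Longrightarrow> j \<in> {1..k} \<Longrightarrow> cls i = cls j \<Longrightarrow> coord i x = coord j x"
  using assms unfolding diagonal_def by blast+

text \<open>
  The sum of a class with a single member \<open>i\<close> is \<open>r i\<close>, which may be reducible, for instance if it is
  not primitive; it is therefore represented by irreducible points instead.
\<close>

definition diagonal_generators :: "(real ^ 'n) set" where
  "diagonal_generators = class_sum ` {q \<in> Q. card (members q) \<noteq> 1} \<union> (irreducibles \<inter> diagonal)"

definition repr :: "'c \<Rightarrow> nat" where
  "repr q = (SOME i. i \<in> members q)"

lemma members_sub: "members q \<subseteq> {1..k}" "finite (members q)"
  by (auto simp: members_def)

lemma repr:
  assumes "q \<in> Q" shows "repr q \<in> members q"
proof -
  have "\<exists>i. i \<in> members q" using Q_sub assms unfolding members_def by blast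
  then show ?thesis unfolding repr_def by (rule someI_ex)
qed

lemma coord_class_sum: "j \<in> {1..k} \<Longrightarrow> coord j (class_sum q) = (if cls j = q then 1 else 0)"
  using coord_sum_r[of j "members q" "\<lambda>_. 1"] members_sub by (auto simp: class_sum_def members_def)

lemma class_sum_points: "class_sum q \<in> points"
  unfolding class_sum_def using members_sub(1) by (intro points_sum points_r) blast

lemma class_sum_diagonal: "q \<in> Q \<Longrightarrow> class_sum q \<in> diagonal"
  using class_sum_points[of q] by (intro diagonalI) (auto simp: points_iff coord_class_sum)

lemma class_sum_inj: "inj_on class_sum Q"
proof (rule inj_onI)
  fix p q assume pq: "p \<in> Q" "q \<in> Q" "class_sum p = class_sum q"
  have "repr p \<in> members p" using repr pq by simp
  then show "p = q" using coord_class_sum[of "repr p" p] coord_class_sum[of "repr p" q] pq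
    by (auto simp: members_def split: if_splits)
qed

lemma coord_sum_class_sum:
  assumes "j \<in> {1..k}"
  shows "coord j (\<Sum>q\<in>Q. c q *\<^sub>R class_sum q) = (if cls j \<in> Q then c (cls j) else 0)"
proof -
  have "coord j (\<Sum>q\<in>Q. c q *\<^sub>R class_sum q) = (\<Sum>q\<in>Q. if q = cls j then c q else 0)"
    unfolding coord_simps by (intro sum.cong refl) (simp add: coord_class_sum[OF assms])
  also have "\<dots> = (if cls j \<in> Q then c (cls j) else 0)" using finite_Q by simp
  finally show ?thesis .
qed

lemma class_sum_span: "class_sum q \<in> span (r ` {1..k})"
  using class_sum_points lattice_span by (auto simp: points_iff)

lemma diagonal_expansion:
  assumes x: "x \<in> diagonal" shows "x = (\<Sum>q\<in>Q. coord (repr q) x *\<^sub>R class_sum q)"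
proof (rule coord_ext)
  show "x \<in> span (r ` {1..k})" using diagonalD(1)[OF x] by (rule lattice_span)
  show "(\<Sum>q\<in>Q. coord (repr q) x *\<^sub>R class_sum q) \<in> span (r ` {1..k})"
    by (intro span_sum span_scale class_sum_span)
  fix j assume j: "j \<in> {1..k}"
  show "coord j x = coord j (\<Sum>q\<in>Q. coord (repr q) x *\<^sub>R class_sum q)"
  proof (cases "cls j \<in> Q")
    case True
    then have "coord j x = coord (repr (cls j)) x" 
      using repr[OF True] j by (intro diagonalD(3)[OF x]) (auto simp: members_def)
    then show ?thesis using True coord_sum_class_sum[OF j] by simp
  next
    case False then show ?thesis using coord_sum_class_sum[OF j] diagonalD(2)[OF x j] by simp
  qed
qed

sublocale diagonal: additive_group_in diagonal
proof
  show "0 \<in> diagonal" by (intro diagonalI) (auto simp: lattice_0)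
  fix x y assume xy: "x \<in> diagonal" "y \<in> diagonal"
  show "x - y \<in> diagonal"
  proof (rule diagonalI)
    show "x - y \<in> lattice" using diagonalD(1) xy lattice_diff by blast
    show "coord i (x - y) = 0" if "i \<in> {1..k}" "cls i \<notin> Q" for i
      using diagonalD(2)[OF xy(1) that] diagonalD(2)[OF xy(2) that] by simp
    show "coord i (x - y) = coord j (x - y)" if "i \<in> {1..k}" "j \<in> {1..k}" "cls i = cls j" for i j
      using diagonalD(3)[OF xy(1) that] diagonalD(3)[OF xy(2) that] by simp
  qed
qed

lemma diagonal_generators_sub: "diagonal_generators \<subseteq> diagonal" "diagonal_generators \<subseteq> points"
  using class_sum_diagonal class_sum_points irreducibles_points by (auto simp: diagonal_generators_def)

lemma finite_diagonal_generators: "finite diagonal_generators"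
  using finite_Q finite_irreducibles by (simp add: diagonal_generators_def)

lemma dim_diagonal_generators: "dim diagonal_generators \<le> card Q"
proof -
  have "diagonal_generators \<subseteq> span (class_sum ` Q)"
  proof
    fix x assume "x \<in> diagonal_generators"
    then have "x = (\<Sum>q\<in>Q. coord (repr q) x *\<^sub>R class_sum q)"
      using diagonal_expansion diagonal_generators_sub by blast
    also have "\<dots> \<in> span (class_sum ` Q)" by (intro span_sum span_scale span_base imageI)
    finally show "x \<in> span (class_sum ` Q)" .
  qed
  then have "dim diagonal_generators \<le> card (class_sum ` Q)" using finite_Q by (intro dim_le_card) auto
  also have "\<dots> \<le> card Q" using finite_Q by (rule card_image_le)
  finally show ?thesis .
qed

text \<open>
  After subtracting multiples of class sums all coordinates are less than one. Irreducible summands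
  of such a point are diagonal as well, because coordinates in \<open>[0, 1)\<close> that differ by an integer are
  equal.
\<close>

lemma diagonal_natural_combination:
  assumes x: "x \<in> diagonal" "x \<in> points"
  shows "\<exists>m :: _ \<Rightarrow> nat. x = (\<Sum>s\<in>diagonal_generators. of_nat (m s) *\<^sub>R s)"
proof -
  let ?S = diagonal_generators
  define N where "N = {y. \<exists>m :: _ \<Rightarrow> nat. y = (\<Sum>s\<in>?S. of_nat (m s) *\<^sub>R s)}"
  have N0: "0 \<in> N" unfolding N_def by (intro CollectI exI[of _ "\<lambda>_. 0"]) simp
  have N_add: "a + b \<in> N" if ab: "a \<in> N" "b \<in> N" for a b
  proof -
    obtain m where "a = (\<Sum>s\<in>?S. of_nat (m s :: nat) *\<^sub>R s)" using ab(1) unfolding N_def by auto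
    moreover obtain m' where "b = (\<Sum>s\<in>?S. of_nat (m' s :: nat) *\<^sub>R s)" using ab(2) unfolding N_def by auto
    ultimately have "a + b = (\<Sum>s\<in>?S. of_nat (m s + m' s) *\<^sub>R s)"
      by (simp only: of_nat_add scaleR_add_left sum.distrib)
    then show ?thesis unfolding N_def by (intro CollectI exI[of _ "\<lambda>s. m s + m' s"])
  qed
  have N_scale: "of_nat n *\<^sub>R a \<in> N" if "a \<in> N" for n a
    using that by (induction n) (simp_all add: N0 N_add scaleR_add_left)
  have N_sum: "sum g A \<in> N" if "\<And>a. a \<in> A \<Longrightarrow> g a \<in> N" for g and A :: "'c set"
    using that by (induction A rule: infinite_finite_induct) (auto simp: N0 N_add)
  have N_below: "y \<in> N" if "y \<in> points" "\<And>h. h \<in> irreducibles \<Longrightarrow> y - h \<in> points \<Longrightarrow> h \<in> diagonal" for y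
    unfolding N_def using that decomposition_below[OF that(1) _ finite_diagonal_generators]
    by (auto simp: diagonal_generators_def)
  have small_diagonal: "h \<in> diagonal"
    if y: "y \<in> diagonal" "y - h \<in> points" and h: "h \<in> points"
      and lt: "\<And>i. i \<in> {1..k} \<Longrightarrow> coord i y < 1" for y h
  proof -
    have le: "0 \<le> coord i h" "coord i h \<le> coord i y" if "i \<in> {1..k}" for i
      using y(2) h that by (force simp: points_iff)+
    have "h \<in> lattice" using h by (simp add: points_iff)
    moreover have "coord i h = 0" if "i \<in> {1..k}" "cls i \<notin> Q" for i
      using le[OF that(1)] diagonalD(2)[OF y(1) that] by simp
    moreover have "coord i h = coord j h" if ij: "i \<in> {1..k}" "j \<in> {1..k}" "cls i = cls j" for i j
    proof -
      have "h \<in> lattice" using h by (simp add: points_iff)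
      then obtain n :: int where n: "coord i h - coord j h = n" using same_class[OF ij] by (auto elim: Ints_cases)
      have "\<bar>coord i h - coord j h\<bar> < 1" using le[OF ij(1)] le[OF ij(2)] lt[OF ij(1)] lt[OF ij(2)] by linarith
      then have "n = 0" unfolding n by linarith
      then show ?thesis using n by simp
    qed
    ultimately show ?thesis by (rule diagonalI)
  qed
  have class_N: "class_sum q \<in> N" if q: "q \<in> Q" for q
  proof (cases "card (members q) = 1")
    case False
    then have "class_sum q \<in> ?S" using q by (auto simp: diagonal_generators_def)
    moreover have "(\<Sum>s\<in>?S. of_nat (if s = class_sum q then 1 else 0) *\<^sub>R s) = (\<Sum>s\<in>?S. if s = class_sum q then s else 0)"
      by (intro sum.cong) auto
    ultimately have "class_sum q = (\<Sum>s\<in>?S. of_nat (if s = class_sum q then 1 else 0) *\<^sub>R s)"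
      using finite_diagonal_generators by simp
    then show ?thesis unfolding N_def by (intro CollectI exI[of _ "\<lambda>s. if s = class_sum q then 1 else 0"])
  next
    case True
    then obtain i where i: "members q = {i}" by (rule card_1_singletonE)
    then have ik: "i \<in> {1..k}" "cls i = q" by (auto simp: members_def)
    have only: "j = i" if "j \<in> {1..k}" "cls j = q" for j using i that by (auto simp: members_def)
    show ?thesis
    proof (rule N_below[OF class_sum_points])
      fix h assume h: "h \<in> irreducibles" "class_sum q - h \<in> points"
      have le: "0 \<le> coord j h" "coord j h \<le> (if cls j = q then 1 else 0)" if "j \<in> {1..k}" for j
        using h(2) irreducibles_points[OF h(1)] that coord_class_sum[OF that, of q] by (force simp: points_iff)+
      have z: "coord j h = 0" if "j \<in> {1..k}" "j \<noteq> i" for j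
      proof -
        have "cls j \<noteq> q" using only that by blast
        then show ?thesis using le[OF that(1)] by simp
      qed
      have "h \<in> lattice" using irreducibles_points[OF h(1)] by (simp add: points_iff)
      moreover have "coord j h = 0" if "j \<in> {1..k}" "cls j \<notin> Q" for j
        using z[OF that(1)] that(2) ik q by metis
      moreover have "coord j h = coord j' h" if "j \<in> {1..k}" "j' \<in> {1..k}" "cls j = cls j'" for j j'
      proof (cases "j = i \<or> j' = i")
        case True
        then have "j = i \<and> j' = i" using only that ik by metis
        then show ?thesis by simp
      next
        case False
        then show ?thesis using z that by simp
      qed
      ultimately show "h \<in> diagonal" by (rule diagonalI)
    qed
  qed
  define w where "w = (\<Sum>q\<in>Q. of_nat (nat \<lfloor>coord (repr q) x\<rfloor>) *\<^sub>R class_sum q)"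
  have "w \<in> N" unfolding w_def by (intro N_sum N_scale class_N)
  have "w \<in> diagonal" unfolding w_def
    by (intro diagonal.sum_mem diagonal.of_nat_mem class_sum_diagonal)
  then have xw: "x - w \<in> diagonal" using x diagonal.diff_mem by blast
  have frac: "coord j (x - w) = frac (coord j x)" if j: "j \<in> {1..k}" for j
  proof (cases "cls j \<in> Q")
    case True
    then have "coord j x = coord (repr (cls j)) x" 
      using repr[OF True] j by (intro diagonalD(3)[OF x(1)]) (auto simp: members_def)
    moreover have "0 \<le> coord j x" using x j by (simp add: points_iff)
    ultimately show ?thesis using True unfolding w_def coord_simps(2) coord_sum_class_sum[OF j]
      by (simp add: frac_def)
  next
    case False
    then show ?thesis using diagonalD(2)[OF x(1) j] unfolding w_def coord_simps(2) coord_sum_class_sum[OF j]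
      by (simp add: frac_def)
  qed
  have "x - w \<in> points" using diagonalD(1)[OF xw] frac by (simp add: points_iff del: coord_simps)
  then have "x - w \<in> N"
  proof (rule N_below)
    fix h assume "h \<in> irreducibles" "x - w - h \<in> points"
    then show "h \<in> diagonal"
      using small_diagonal[OF xw] irreducibles_points frac frac_lt_1 by (metis (no_types, lifting))
  qed
  then have "x - w + w \<in> N" using \<open>w \<in> N\<close> N_add by blast
  then show ?thesis unfolding N_def by simp
qed

sublocale diagonal: cone_generators diagonal diagonal_generators "\<lambda>x. \<Sum>i=1..k. coord i x"
proof (intro cone_generators.intro cone_generators_axioms.intro diagonal.additive_group_in_axioms)
  show "linear (\<lambda>x. \<Sum>i=1..k. coord i x)"
    by (rule linearI) (simp_all add: sum.distrib sum_distrib_left)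
  fix s assume s: "s \<in> diagonal_generators"
  have sp: "s \<in> points" using s diagonal_generators_sub by blast
  have "s \<noteq> 0"
  proof
    assume "s = 0"
    then have "0 \<in> class_sum ` Q" using s by (auto simp: diagonal_generators_def irreducibles_def)
    then obtain q where q: "q \<in> Q" "class_sum q = 0" by auto
    then show False using coord_class_sum[of "repr q" q] repr[of q] by (auto simp: members_def)
  qed
  moreover have "s \<in> span (r ` {1..k})" using sp lattice_span by (simp add: points_iff)
  ultimately have "\<exists>i\<in>{1..k}. coord i s \<noteq> 0"
    using coord_ext[of s 0] by (metis coord_simps(5) span_zero)
  then obtain i where "i \<in> {1..k}" "coord i s \<noteq> 0" by blast
  moreover have "\<forall>i\<in>{1..k}. 0 \<le> coord i s" using sp by (simp add: points_iff)
  ultimately show "0 < (\<Sum>i=1..k. coord i s)" by (intro sum_pos2[of _ i]) (auto simp: less_le)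
next
  fix l assume l: "\<And>s. s \<in> diagonal_generators \<Longrightarrow> 0 \<le> l s" "(\<Sum>s\<in>diagonal_generators. l s *\<^sub>R s) \<in> diagonal"
  have "0 \<le> coord i (\<Sum>s\<in>diagonal_generators. l s *\<^sub>R s)" if "i \<in> {1..k}" for i
    using l(1) diagonal_generators_sub(2) that unfolding coord_simps
    by (intro sum_nonneg mult_nonneg_nonneg) (auto simp: points_iff)
  then have "(\<Sum>s\<in>diagonal_generators. l s *\<^sub>R s) \<in> points"
    using diagonalD(1)[OF l(2)] by (simp add: points_iff del: coord_simps)
  then show "\<exists>m :: _ \<Rightarrow> nat. (\<Sum>s\<in>diagonal_generators. l s *\<^sub>R s) = (\<Sum>s\<in>diagonal_generators. of_nat (m s) *\<^sub>R s)"
    using diagonal_natural_combination l(2) by blast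
qed (use finite_diagonal_generators diagonal_generators_sub in auto)

lemma diagonal_short_combination:
  assumes "x \<in> diagonal" "x \<in> points"
  shows "\<exists>T\<subseteq>diagonal_generators. card T \<le> card Q \<and> (\<exists>m :: _ \<Rightarrow> nat. x = (\<Sum>t\<in>T. of_nat (m t) *\<^sub>R t))"
proof -
  obtain m :: "_ \<Rightarrow> nat" where m: "x = (\<Sum>s\<in>diagonal_generators. of_nat (m s) *\<^sub>R s)"
    using diagonal_natural_combination[OF assms] by (elim exE) (rule that)
  have "dim diagonal_generators \<le> 3" using dim_diagonal_generators Q_card by simp
  from diagonal.integral_caratheodory_dim3[OF this _ m assms(1)]
  obtain T where "T \<subseteq> diagonal_generators" "card T \<le> dim diagonal_generators"
    "\<exists>m :: _ \<Rightarrow> nat. x = (\<Sum>t\<in>T. of_nat (m t) *\<^sub>R t)" by auto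
  then show ?thesis using dim_diagonal_generators order_trans by blast
qed

end

context coset_classes begin

text \<open>
  A coordinate of a lattice point on the ray of \<open>r i\<close> is an integer if some other index shares the
  class of \<open>i\<close>, as the coordinate at that index is zero.
\<close>

lemma irreducible_r_unless_alone:
  assumes i: "i \<in> {1..k}" and "cls i \<in> Q \<Longrightarrow> card (members (cls i)) \<noteq> 1"
  shows "r i \<in> irreducibles"
proof (rule irreducible_r[OF i])
  fix x assume x: "x \<in> points" "\<And>j. j \<in> {1..k} \<Longrightarrow> j \<noteq> i \<Longrightarrow> coord j x = 0"
  have xl: "x \<in> lattice" using x(1) by (simp add: points_iff)
  show "coord i x \<in> \<int>"
  proof (cases "cls i \<in> Q")
    case False then show ?thesis using trivial_class i xl by blast
  next
    case True
    then have "members (cls i) \<noteq> {i}" using assms(2) by auto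
    moreover have "i \<in> members (cls i)" using i by (simp add: members_def)
    ultimately obtain j where "j \<in> members (cls i)" "j \<noteq> i" by blast
    then have j: "j \<in> {1..k}" "cls i = cls j" "coord j x = 0" using x(2) by (auto simp: members_def)
    then show ?thesis using same_class[OF i j(1,2) xl] by simp
  qed
qed

text \<open>
  Let \<open>x\<close> be the diagonal point whose coordinate on each class is the least coordinate of \<open>z\<close> there;
  the remainder \<open>z - x\<close> is a natural combination of the \<open>r i\<close> that omits the minimising index of each
  nontrivial class. If a class sum occurs among the generators used for \<open>x\<close>, it is dissolved into its
  \<open>r i\<close>: the number of generators drops by one, while at most the omitted index of that class is
  added. So the total is bounded by \<open>card Q + (k - card Q)\<close>.
\<close>

lemma short_rep_k:
  assumes z: "z \<in> points"
  shows "short_rep z k"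
proof -
  define low where "low q = arg_min_on (\<lambda>i. coord i z) (members q)" for q
  have mem: "members q \<noteq> {}" if "q \<in> Q" for q using repr[OF that] by blast
  have low: "low q \<in> members q" if "q \<in> Q" for q
    unfolding low_def by (rule arg_min_if_finite(1)[OF members_sub(2) mem[OF that]])
  have low_le: "coord (low (cls i)) z \<le> coord i z" if "i \<in> {1..k}" "cls i \<in> Q" for i
    unfolding low_def using that by (intro arg_min_least[OF members_sub(2) mem]) (auto simp: members_def)
  have lowD: "low q \<in> {1..k}" "cls (low q) = q" if "q \<in> Q" for q using low[OF that] by (auto simp: members_def)
  have zl: "z \<in> lattice" and z0: "\<And>i. i \<in> {1..k} \<Longrightarrow> 0 \<le> coord i z" using z by (auto simp: points_iff)
  define x where "x = (\<Sum>q\<in>Q. coord (low q) z *\<^sub>R class_sum q)"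
  have coord_x: "coord i x = (if cls i \<in> Q then coord (low (cls i)) z else 0)" if "i \<in> {1..k}" for i
    unfolding x_def by (rule coord_sum_class_sum[OF that])
  have x_span: "x \<in> span (r ` {1..k})" unfolding x_def by (intro span_sum span_scale class_sum_span)
  have int: "coord i z - coord i x \<in> \<int>" "0 \<le> coord i z - coord i x" if i: "i \<in> {1..k}" for i
    using same_class[OF i lowD(1) _ zl, of "cls i"] trivial_class[OF i _ zl] low_le[OF i] lowD(2)[of "cls i"] z0[OF i]
    by (auto simp: coord_x[OF i])
  define n where "n i = nat \<lfloor>coord i z - coord i x\<rfloor>" for i
  have n: "real (n i) = coord i z - coord i x" if "i \<in> {1..k}" for i
    using int[OF that] by (auto simp: n_def elim!: Ints_cases)
  have zx: "z = x + (\<Sum>i=1..k. of_nat (n i) *\<^sub>R r i)"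
  proof (rule coord_ext)
    show "z \<in> span (r ` {1..k})" using zl by (rule lattice_span)
    show "x + (\<Sum>i=1..k. of_nat (n i) *\<^sub>R r i) \<in> span (r ` {1..k})"
      using x_span by (intro span_add span_sum span_scale span_r)
    fix i assume i: "i \<in> {1..k}"
    show "coord i z = coord i (x + (\<Sum>i=1..k. of_nat (n i) *\<^sub>R r i))"
      unfolding coord_simps(1) using coord_sum_r[OF i order_refl, of "\<lambda>i. of_nat (n i)"] n[OF i] i by simp
  qed
  have "(\<Sum>i=1..k. of_nat (n i) *\<^sub>R r i) \<in> lattice" by (intro lattice_sum lattice_scale lattice_r) auto
  then have xl: "x \<in> lattice" using zl lattice_diff zx by (metis add_diff_cancel_right')
  have x_diag: "x \<in> diagonal" using xl by (rule diagonalI) (auto simp: coord_x)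
  have x_points: "x \<in> points" using xl z0 lowD(1) by (simp add: points_iff coord_x)
  obtain T m where T: "T \<subseteq> diagonal_generators" "card T \<le> card Q"
    and m: "x = (\<Sum>t\<in>T. of_nat (m t :: nat) *\<^sub>R t)"
    using diagonal_short_combination[OF x_diag x_points] by (elim exE conjE) (rule that)
  have finT: "finite T" using T finite_diagonal_generators by (auto intro: finite_subset)
  define Q2 where "Q2 = {q \<in> Q. card (members q) \<noteq> 1 \<and> class_sum q \<in> T}"
  define T1 where "T1 = T - class_sum ` Q2"
  have Q2: "Q2 \<subseteq> Q" "finite Q2" using finite_Q by (auto simp: Q2_def)
  have T1: "T1 \<subseteq> irreducibles" using T by (auto simp: T1_def Q2_def diagonal_generators_def)
  have inj: "inj_on class_sum Q2" using class_sum_inj Q2(1) by (rule inj_on_subset)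
  have sub: "class_sum ` Q2 \<subseteq> T" by (auto simp: Q2_def)
  have cardT: "card T1 + card Q2 = card T"
    using card_Diff_subset[of "class_sum ` Q2" T] card_mono[OF finT sub] Q2(2) sub card_image[OF inj]
    by (simp add: T1_def)
  have "x = (\<Sum>t\<in>T1. of_nat (m t) *\<^sub>R t) + (\<Sum>t\<in>class_sum ` Q2. of_nat (m t) *\<^sub>R t)"
    unfolding m T1_def by (rule sum.subset_diff[OF sub finT])
  then have x_split: "x = (\<Sum>t\<in>T1. of_nat (m t) *\<^sub>R t) + (\<Sum>q\<in>Q2. of_nat (m (class_sum q)) *\<^sub>R class_sum q)"
    by (simp only: sum.reindex[OF inj] o_def)
  define n' where "n' i = n i + (if cls i \<in> Q2 then m (class_sum (cls i)) else 0)" for i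
  have "(\<Sum>q\<in>Q2. of_nat (m (class_sum q)) *\<^sub>R class_sum q) =
      (\<Sum>i=1..k. of_nat (if cls i \<in> Q2 then m (class_sum (cls i)) else 0) *\<^sub>R r i)"
  proof (rule coord_ext)
    fix i assume i: "i \<in> {1..k}"
    have "coord i (\<Sum>q\<in>Q2. of_nat (m (class_sum q)) *\<^sub>R class_sum q) =
        (\<Sum>q\<in>Q2. if q = cls i then of_nat (m (class_sum q)) else 0)"
      unfolding coord_simps by (intro sum.cong refl) (simp add: coord_class_sum[OF i])
    also have "\<dots> = of_nat (if cls i \<in> Q2 then m (class_sum (cls i)) else 0)" using Q2 by simp
    also have "\<dots> = coord i (\<Sum>i=1..k. of_nat (if cls i \<in> Q2 then m (class_sum (cls i)) else 0) *\<^sub>R r i)"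
      by (subst coord_sum_r[OF i order_refl]) (simp only: i if_True)
    finally show "coord i (\<Sum>q\<in>Q2. of_nat (m (class_sum q)) *\<^sub>R class_sum q) =
        coord i (\<Sum>i=1..k. of_nat (if cls i \<in> Q2 then m (class_sum (cls i)) else 0) *\<^sub>R r i)" .
  qed (intro span_sum span_scale class_sum_span span_r; assumption)+
  then have z_eq: "z = (\<Sum>t\<in>T1. of_nat (m t) *\<^sub>R t) + (\<Sum>i=1..k. of_nat (n' i) *\<^sub>R r i)"
    unfolding n'_def of_nat_add scaleR_add_left sum.distrib using zx x_split by (simp only: ac_simps)
  define J where "J = {i \<in> {1..k}. n' i \<noteq> 0}"
  have Jsum: "(\<Sum>i=1..k. of_nat (n' i) *\<^sub>R r i) = (\<Sum>i\<in>J. of_nat (n' i) *\<^sub>R r i)"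
    by (rule sum.mono_neutral_right) (auto simp: J_def)
  have n_low: "n (low q) = 0" if "q \<in> Q" for q
    using n[OF lowD(1)[OF that]] coord_x[OF lowD(1)[OF that]] lowD(2)[OF that] that by simp
  have J_irr: "r i \<in> irreducibles" if i: "i \<in> J" for i
  proof (rule irreducible_r_unless_alone)
    show ik: "i \<in> {1..k}" using i by (simp add: J_def)
    assume q: "cls i \<in> Q"
    show "card (members (cls i)) \<noteq> 1"
    proof
      assume 1: "card (members (cls i)) = 1"
      then obtain a where "members (cls i) = {a}" by (rule card_1_singletonE)
      moreover have "i \<in> members (cls i)" using ik by (simp add: members_def)
      ultimately have "low (cls i) = i" using low[OF q] by auto
      then have "n i = 0" using n_low[OF q] by simp
      moreover have "cls i \<notin> Q2" using 1 by (simp add: Q2_def)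
      ultimately show False using i by (simp add: J_def n'_def)
    qed
  qed
  have "J \<subseteq> {1..k} - low ` (Q - Q2)"
    using n_low lowD(2) by (auto simp: J_def n'_def split: if_splits)
  then have "card J \<le> card ({1..k} - low ` (Q - Q2))" by (intro card_mono) auto
  also have "\<dots> = k - card (low ` (Q - Q2))"
    using lowD(1) finite_Q by (subst card_Diff_subset) auto
  also have "card (low ` (Q - Q2)) = card (Q - Q2)"
    by (intro card_image inj_on_inverseI[of _ cls]) (auto simp: lowD(2))
  also have "\<dots> = card Q - card Q2" using Q2 by (simp add: card_Diff_subset)
  finally have cJ: "card J \<le> k - (card Q - card Q2)" .
  have "card Q \<le> card (cls ` {1..k})" using Q_sub by (intro card_mono) auto
  also have "\<dots> \<le> k" using card_image_le[of "{1..k}" cls] by simp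
  finally have k: "card T1 + card J \<le> k" using cJ cardT T(2) card_mono[OF finite_Q Q2(1)] by linarith
  have "short_rep (\<Sum>t\<in>T1. of_nat (m t) *\<^sub>R t) (card T1)"
    unfolding short_rep_def using T1 by (intro exI[of _ T1] exI[of _ m] conjI) auto
  moreover have "short_rep (\<Sum>i\<in>J. of_nat (n' i) *\<^sub>R r i) (card J)"
    using J_irr by (intro short_rep_r) (auto simp: J_def)
  ultimately show ?thesis unfolding z_eq Jsum using short_rep_add short_rep_mono[OF _ k] by blast
qed

end

theorem corollary4p2:
  fixes r :: "nat \<Rightarrow> real ^ 'n" and k :: nat
  assumes integral: "\<forall>i\<in>{1..k}. r i \<in> integer_points"
    and indep: "lin_indep_family k r"
    and cosets: "let L = span (r ` {1..k}); M = dual_lattice (L \<inter> integer_points)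
      in card ((\<lambda>i. dual_basis k r i +o M) ` {1..k} - {M}) \<le> 3"
  shows "integral_caratheodory (pos_hull k r) \<and> ICR (pos_hull k r) = k"
proof -
  define M where "M = dual_lattice (span (r ` {1..k}) \<inter> integer_points)"
  define cls where "cls i = dual_basis k r i +o M" for i
  interpret simplicial_cone r k using integral indep by unfold_locales auto
  have M0: "0 \<in> M" by (simp add: M_def dual_lattice_def span_zero)
  have M_int: "x \<bullet> y \<in> \<int>" if "y \<in> M" "x \<in> lattice" for x y
    using that by (simp add: M_def dual_lattice_def lattice_def)
  interpret coset_classes r k cls "cls ` {1..k} - {M}"
  proof unfold_locales
    show "card (cls ` {1..k} - {M}) \<le> 3" using cosets by (simp add: Let_def M_def cls_def)
  next
    fix i j x assume "cls i = cls j" and x: "x \<in> lattice"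
    moreover have "dual_basis k r i \<in> cls i" using M0 by (force simp: cls_def elt_set_plus_def)
    ultimately obtain y where "y \<in> M" "dual_basis k r i = dual_basis k r j + y"
      by (auto simp: cls_def elt_set_plus_def)
    then show "coord i x - coord j x \<in> \<int>" using M_int x by (simp add: coord_def inner_add_right)
  next
    fix i x assume "i \<in> {1..k}" "cls i \<notin> cls ` {1..k} - {M}" and x: "x \<in> lattice"
    then have "cls i = M" by auto
    moreover have "dual_basis k r i \<in> cls i" using M0 by (force simp: cls_def elt_set_plus_def)
    ultimately show "coord i x \<in> \<int>" using M_int x by (simp add: coord_def)
  qed auto
  have "ICR (pos_hull k r) = k" using short_rep_k by (rule ICR_eqI)
  then show ?thesis by (simp add: integral_caratheodory_def dim_pos_hull)
qed

end
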